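(* Let $n\ge 2$ be an integer, let $K\ge 0$, and let $(M,\mathsf d,\mathsf m)$ be a proper metric measure space (every bounded closed subset of $M$ is compact) which satisfies the curvature-dimension condition $\mathsf{CD}(K,n)$. Let $p\in(1,n)$, and assume that for some $x_0\in M$ $$\liminf_{\rho\to 0}\frac{\mathsf m(B_{x_0}(\rho))}{\omega_n\rho^n}=1 .$$ If the Faber-Krahn-type inequality $$\|u\|_{L^1}\le\mathcal C\,\||\nabla u|_{\mathsf d}\|_{L^p}\,\mathsf m(\mathrm{supp}(u))^{1-\frac1{p^\star}}\qquad\text{for all } u\in\mathrm{Lip}_0(M)$$ holds for some $\mathcal C\ge\mathcal F_{p,n}$, then $K=0$ and $$\mathsf m(B_x(\rho))\ge\left(\frac{\mathcal F_{p,n}}{\mathcal C}\right)^{n}\omega_n\rho^n\qquad\text{for all } x\in M\text{ and }\rho\ge0.$$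
   Context: Metric measure space: $(M,\mathsf d)$ is a complete separable metric space and $\mathsf m$ is a locally finite Borel measure on $M$ that is strictly positive, i.e. $\mathrm{supp}[\mathsf m]=M$. $B_x(r)=\{y\in M:\mathsf d(x,y)<r\}$. $\omega_n=\pi^{n/2}/\Gamma(\frac n2+1)$. $\mathrm{Lip}_0(M)$ is the space of Lipschitz functions $u:M\to\mathbb R$ with compact support; for such $u$, $|\nabla u|_{\mathsf d}(x)=\limsup_{y\to x}\frac{|u(y)-u(x)|}{\mathsf d(x,y)}$, $x\in M$, and $\mathrm{supp}(u)$ is the support of $u$. $\|u\|_{L^q}=(\int_M|u|^q\,d\mathsf m)^{1/q}$. Curvature-dimension condition: $\mathcal P_2(M,\mathsf d)$ is the $L^2$-Wasserstein space of probability measures on $M$ and $\mathcal P_2(M,\mathsf d,\mathsf m)$ its subspace of $\mathsf m$-absolutely continuous measures. For $N\ge1$, the Rényi entropy is $S_N(\mu|\mathsf m)=-\int_M\rho^{-1/N}d\mu$, where $\rho$ is the density of the absolutely continuous part $\mu^c$ in the decomposition $\mu=\mu^c+\mu^s=\rho\,\mathsf m+\mu^s$. For $K\ge0$, $N\ge1$, $t\in[0,1]$, $s\ge0$ let $\tau_{K,N}^{(t)}(s)=+\infty$ if $Ks^2\ge (N-1)\pi^2$; $\tau_{K,N}^{(t)}(s)=t^{1/N}\left(\sin\left(\sqrt{\tfrac{K}{N-1}}\,ts\right)\big/\sin\left(\sqrt{\tfrac{K}{N-1}}\,s\right)\right)^{1-1/N}$ if $0<Ks^2<(N-1)\pi^2$;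 $\tau_{K,N}^{(t)}(s)=t$ if $Ks^2=0$. $(M,\mathsf d,\mathsf m)$ satisfies $\mathsf{CD}(K,N)$ if for all $\mu_0,\mu_1\in\mathcal P_2(M,\mathsf d,\mathsf m)$ there exist an optimal coupling $\pi$ of $\mu_0,\mu_1$ and a geodesic $\Gamma:[0,1]\to\mathcal P_2(M,\mathsf d,\mathsf m)$ joining $\mu_0$ and $\mu_1$ such that for every $t\in[0,1]$ and $N'\ge N$ $$S_{N'}(\Gamma(t)|\mathsf m)\le-\int_{M\times M}\left[\tau_{K,N'}^{(1-t)}(\mathsf d(y_0,y_1))\rho_0^{-1/N'}(y_0)+\tau_{K,N'}^{(t)}(\mathsf d(y_0,y_1))\rho_1^{-1/N'}(y_1)\right]d\pi(y_0,y_1),$$ where $\rho_0,\rho_1$ are the densities of $\mu_0,\mu_1$ with respect to $\mathsf m$. Constants: $p'=\frac p{p-1}$, $p^\star=\frac{pn}{n-p}$, and $$\mathcal F_{p,n}=n^{-\frac1p}\,\omega_n^{-\frac1n}\,(p'+n)^{-\frac1{p'}},$$ which is the best constant in the Faber-Krahn-type inequality on $\mathbb R^n$. *)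

theory Defs
  imports "HOL-Probability.Probability"
begin

text \<open>The underlying complete separable metric space is the type \<open>'a :: polish_space\<close>
  (class of complete, second countable metric spaces) with its distance \<^const>\<open>dist\<close>.\<close>

section \<open>Metric measure spaces\<close>

definition measure_support :: "'a::topological_space measure \<Rightarrow> 'a set" where
  "measure_support m = {x. \<forall>U. open U \<and> x \<in> U \<longrightarrow> emeasure m U > 0}"

definition locally_finite_measure :: "'a::topological_space measure \<Rightarrow> bool" where
  "locally_finite_measure m \<longleftrightarrow> (\<forall>x. \<exists>U. open U \<and> x \<in> U \<and> emeasure m U < \<infinity>)"

definition metric_measure_space :: "'a::polish_space measure \<Rightarrow> bool" where
  "metric_measure_space m \<longleftrightarrow>
     sets m = sets borel \<and> locally_finite_measure m \<and> measure_support m = UNIV"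

definition proper_space :: "'a::metric_space itself \<Rightarrow> bool" where
  "proper_space _ \<longleftrightarrow> (\<forall>S::'a set. bounded S \<and> closed S \<longrightarrow> compact S)"

section \<open>Lipschitz functions with compact support\<close>

definition fun_support :: "('a::topological_space \<Rightarrow> real) \<Rightarrow> 'a set" where
  "fun_support u = closure {x. u x \<noteq> 0}"

definition Lip0 :: "('a::metric_space \<Rightarrow> real) set" where
  "Lip0 = {u. (\<exists>L. L-lipschitz_on UNIV u) \<and> compact (fun_support u)}"

text \<open>The upper limit is taken in \<^typ>\<open>ennreal\<close>, so it is \<open>0\<close> at isolated points; it is
  finite for Lipschitz \<open>u\<close>.\<close>
definition local_slope :: "('a::metric_space \<Rightarrow> real) \<Rightarrow> 'a \<Rightarrow> real" where
  "local_slope u x = enn2real (Limsup (at x) (\<lambda>y. ennreal (\<bar>u y - u x\<bar> / dist x y)))"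

text \<open>This is used only for functions in \<^const>\<open>Lip0\<close> and their local slopes; these are bounded
  Borel functions vanishing off a compact set, so the Bochner integral below is never
  the default value of a divergent integral.\<close>
definition Lq_norm :: "'a measure \<Rightarrow> real \<Rightarrow> ('a \<Rightarrow> real) \<Rightarrow> real" where
  "Lq_norm m q f = (\<integral>x. \<bar>f x\<bar> powr q \<partial>m) powr (1 / q)"

section \<open>Wasserstein space\<close>

definition P2 :: "'a::metric_space measure set" where
  "P2 = {\<mu>. sets \<mu> = sets borel \<and> prob_space \<mu> \<and>
            (\<exists>x0. (\<integral>\<^sup>+x. ennreal ((dist x0 x)\<^sup>2) \<partial>\<mu>) < \<infinity>)}"

definition P2_ac :: "'a::metric_space measure \<Rightarrow> 'a measure set" where
  "P2_ac m = {\<mu> \<in> P2. absolutely_continuous m \<mu>}"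

definition couplings :: "'a::metric_space measure \<Rightarrow> 'a measure \<Rightarrow> ('a \<times> 'a) measure set" where
  "couplings \<mu> \<nu> = {\<pi>. sets \<pi> = sets (borel \<Otimes>\<^sub>M borel) \<and> prob_space \<pi> \<and>
                      distr \<pi> borel fst = \<mu> \<and> distr \<pi> borel snd = \<nu>}"

definition transport_cost :: "('a::metric_space \<times> 'a) measure \<Rightarrow> ennreal" where
  "transport_cost \<pi> = (\<integral>\<^sup>+z. ennreal ((dist (fst z) (snd z))\<^sup>2) \<partial>\<pi>)"

definition optimal_coupling ::
    "'a::metric_space measure \<Rightarrow> 'a measure \<Rightarrow> ('a \<times> 'a) measure \<Rightarrow> bool" where
  "optimal_coupling \<mu> \<nu> \<pi> \<longleftrightarrow>
     \<pi> \<in> couplings \<mu> \<nu> \<and> (\<forall>\<pi>'\<in>couplings \<mu> \<nu>. transport_cost \<pi> \<le> transport_cost \<pi>')"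

definition W2 :: "'a::metric_space measure \<Rightarrow> 'a measure \<Rightarrow> real" where
  "W2 \<mu> \<nu> = sqrt (enn2real (INF \<pi>\<in>couplings \<mu> \<nu>. transport_cost \<pi>))"

text \<open>Minimal geodesics are parametrised proportionally to arc length.\<close>
definition W2_geodesic ::
    "'a::metric_space measure set \<Rightarrow> 'a measure \<Rightarrow> 'a measure \<Rightarrow> (real \<Rightarrow> 'a measure) \<Rightarrow> bool" where
  "W2_geodesic X \<mu> \<nu> \<Gamma> \<longleftrightarrow>
     (\<forall>t\<in>{0..1}. \<Gamma> t \<in> X) \<and> \<Gamma> 0 = \<mu> \<and> \<Gamma> 1 = \<nu> \<and>
     (\<forall>s\<in>{0..1}. \<forall>t\<in>{0..1}. W2 (\<Gamma> s) (\<Gamma> t) = \<bar>s - t\<bar> * W2 \<mu> \<nu>)"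

section \<open>Entropy and the curvature-dimension condition\<close>

text \<open>Density of the absolutely continuous part in the Lebesgue decomposition of \<open>\<mu>\<close> with
  respect to \<open>m\<close>. The singular part is the restriction of \<open>\<mu>\<close> to an \<open>m\<close>-null set \<open>Z\<close>; the version
  of the density equal to \<open>\<infinity>\<close> on \<open>Z\<close> is chosen, so that the singular part does not contribute
  to the entropy.\<close>
definition ac_density :: "'a measure \<Rightarrow> 'a measure \<Rightarrow> 'a \<Rightarrow> ennreal" where
  "ac_density m \<mu> = (SOME \<rho>. \<rho> \<in> borel_measurable m \<and>
     (\<exists>Z\<in>null_sets m. (\<forall>x\<in>Z. \<rho> x = \<infinity>) \<and>
        (\<forall>A\<in>sets m. emeasure \<mu> A = emeasure (density m \<rho>) A + emeasure \<mu> (A \<inter> Z))))"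

text \<open>The power \<open>\<rho>\<^sup>-\<^sup>1\<^sup>/\<^sup>N\<close> of a density. By the conventions of \<^const>\<open>enn2real\<close> and \<^const>\<open>powr\<close>,
  it is \<open>0\<close> where \<open>\<rho> = \<infinity>\<close>, as it should be. It is also \<open>0\<close> where \<open>\<rho> = 0\<close>, which is harmless:
  it is integrated only against \<open>\<mu>\<close> (or a coupling with marginal \<open>\<mu>\<close>), and
  \<open>{\<rho> = 0}\<close> is \<open>\<mu>\<close>-null.\<close>
definition dens_pow :: "real \<Rightarrow> ennreal \<Rightarrow> ennreal" where
  "dens_pow N r = ennreal (enn2real r powr (- 1 / N))"

definition renyi_entropy :: "real \<Rightarrow> 'a measure \<Rightarrow> 'a measure \<Rightarrow> ereal" where
  "renyi_entropy N m \<mu> = - enn2ereal (\<integral>\<^sup>+x. dens_pow N (ac_density m \<mu> x) \<partial>\<mu>)"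

text \<open>The case \<open>K s\<^sup>2 = 0\<close> is tested first; the order matters only for \<open>N = 1\<close>.\<close>
definition distortion :: "real \<Rightarrow> real \<Rightarrow> real \<Rightarrow> real \<Rightarrow> ennreal" where
  "distortion K N t s =
     (if K * s\<^sup>2 = 0 then ennreal t
      else if K * s\<^sup>2 \<ge> (N - 1) * pi\<^sup>2 then \<infinity>
      else ennreal (t powr (1 / N) *
             (sin (sqrt (K / (N - 1)) * t * s) / sin (sqrt (K / (N - 1)) * s)) powr (1 - 1 / N)))"

definition CD :: "real \<Rightarrow> real \<Rightarrow> 'a::polish_space measure \<Rightarrow> bool" where
  "CD K N m \<longleftrightarrow>
     (\<forall>\<mu>0\<in>P2_ac m. \<forall>\<mu>1\<in>P2_ac m. \<exists>\<pi> \<Gamma>.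
        optimal_coupling \<mu>0 \<mu>1 \<pi> \<and> W2_geodesic (P2_ac m) \<mu>0 \<mu>1 \<Gamma> \<and>
        (\<forall>t\<in>{0..1}. \<forall>N'\<ge>N.
           renyi_entropy N' m (\<Gamma> t) \<le>
           - enn2ereal (\<integral>\<^sup>+z.
                 distortion K N' (1 - t) (dist (fst z) (snd z))
                     * dens_pow N' (RN_deriv m \<mu>0 (fst z))
               + distortion K N' t (dist (fst z) (snd z))
                     * dens_pow N' (RN_deriv m \<mu>1 (snd z)) \<partial>\<pi>)))"

section \<open>Constants\<close>

definition conj_exp :: "real \<Rightarrow> real" where
  "conj_exp p = p / (p - 1)"

definition sobolev_exp :: "real \<Rightarrow> real \<Rightarrow> real" where
  "sobolev_exp p n = p * n / (n - p)"

text \<open>\<open>unit_ball_vol n\<close> is \<open>\<omega>\<^sub>n\<close>.\<close>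
definition faber_krahn_const :: "real \<Rightarrow> real \<Rightarrow> real" where
  "faber_krahn_const p n =
     n powr (- 1 / p) * unit_ball_vol n powr (- 1 / n)
       * (conj_exp p + n) powr (- 1 / conj_exp p)"

end

theory Submission
  imports Defs
begin

text \<open>If \<open>\<mu>\<^sub>0\<close> and \<open>\<mu>\<^sub>1\<close> live in concentric balls, every intermediate point of a Wasserstein geodesic
  lives in the interpolated ball: otherwise gluing almost optimal couplings would produce a coupling
  of \<open>\<mu>\<^sub>0\<close> and \<open>\<mu>\<^sub>1\<close> that is too cheap. As the Renyi entropy is bounded by a power of the volume,
  the curvature-dimension condition turns into a volume inequality. For \<open>K > 0\<close> and two far apart
  balls its left-hand side is infinite, so the space is compact and the constant function \<open>1\<close>
  violates the Faber-Krahn-type inequality. For \<open>K = 0\<close> it gives the Bishop-Gromov monotonicity of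
  \<open>m (B\<^sub>x r) / r\<^sup>n\<close>.

  With \<open>q = p / (p - 1)\<close>, test the inequality with \<open>(l\<^sup>q - d(x, \<cdot>)\<^sup>q)\<^sub>+\<close>. By Bishop-Gromov the measure in
  \<open>B\<^sub>x l\<close> is at least as concentrated near \<open>x\<close> as in a Euclidean cone of the same total volume
  \<open>V\<close>, so the left-hand side is at least, and the gradient term at most, its value for this
  cone. This leaves an inequality for \<open>V\<close> alone, which is the claim.\<close>

section \<open>Couplings and the Wasserstein distance\<close>

lemma prob_space_P2: "\<mu> \<in> P2 \<Longrightarrow> prob_space \<mu>"
  and sets_P2: "\<mu> \<in> P2 \<Longrightarrow> sets \<mu> = sets borel"
  by (auto simp: P2_def)

text \<open>The definition of \<open>P2\<close> provides one base point only. Since (s + t)^2 \<le>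
  2 s^2 + 2 t^2 and the mass is finite, every base point serves.\<close>

lemma P2_second_moment:
  fixes \<mu> :: "'a::polish_space measure"
  assumes "\<mu> \<in> P2"
  shows "(\<integral>\<^sup>+x. ennreal ((dist c x)\<^sup>2) \<partial>\<mu>) < \<infinity>"
proof -
  interpret prob_space \<mu> using assms by (rule prob_space_P2)
  have [measurable_cong]: "sets \<mu> = sets borel" using assms by (rule sets_P2)
  obtain a where a: "(\<integral>\<^sup>+x. ennreal ((dist a x)\<^sup>2) \<partial>\<mu>) < \<infinity>"
    using assms by (auto simp: P2_def)
  have "ennreal ((dist c x)\<^sup>2) \<le> 2 * ennreal ((dist a x)\<^sup>2) + ennreal (2 * (dist c a)\<^sup>2)" for x
  proof -
    have "(dist c x)\<^sup>2 \<le> (dist c a + dist a x)\<^sup>2"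
      by (intro power_mono dist_triangle) auto
    also have "\<dots> \<le> 2 * (dist a x)\<^sup>2 + 2 * (dist c a)\<^sup>2"
      using sum_squares_bound[of "dist c a" "dist a x"] by (simp add: power2_sum)
    finally have "ennreal ((dist c x)\<^sup>2) \<le> ennreal (2 * (dist a x)\<^sup>2 + 2 * (dist c a)\<^sup>2)"
      by (rule ennreal_leI)
    then show ?thesis by (simp add: ennreal_plus ennreal_mult)
  qed
  then have "(\<integral>\<^sup>+x. ennreal ((dist c x)\<^sup>2) \<partial>\<mu>)
      \<le> (\<integral>\<^sup>+x. 2 * ennreal ((dist a x)\<^sup>2) + ennreal (2 * (dist c a)\<^sup>2) \<partial>\<mu>)"
    by (intro nn_integral_mono)
  also have "\<dots> = 2 * (\<integral>\<^sup>+x. ennreal ((dist a x)\<^sup>2) \<partial>\<mu>) + ennreal (2 * (dist c a)\<^sup>2)"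
    by (subst nn_integral_add) (auto simp: nn_integral_cmult emeasure_space_1)
  also have "\<dots> < \<infinity>" using a by (simp add: ennreal_mult_less_top)
  finally show ?thesis .
qed

lemma couplingD:
  assumes "\<pi> \<in> couplings \<mu> \<nu>"
  shows "prob_space \<pi>" "sets \<pi> = sets (borel \<Otimes>\<^sub>M borel)"
    "distr \<pi> borel fst = \<mu>" "distr \<pi> borel snd = \<nu>"
  using assms by (auto simp: couplings_def)

lemma coupling_nn_integral:
  assumes "\<pi> \<in> couplings \<mu> \<nu>" "f \<in> borel_measurable borel"
  shows "(\<integral>\<^sup>+z. f (fst z) \<partial>\<pi>) = (\<integral>\<^sup>+x. f x \<partial>\<mu>)"
    and "(\<integral>\<^sup>+z. f (snd z) \<partial>\<pi>) = (\<integral>\<^sup>+x. f x \<partial>\<nu>)"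
proof -
  note [measurable_cong] = couplingD(2)[OF assms(1)]
  show "(\<integral>\<^sup>+z. f (fst z) \<partial>\<pi>) = (\<integral>\<^sup>+x. f x \<partial>\<mu>)"
    unfolding couplingD(3)[OF assms(1), symmetric] using assms(2)
    by (subst nn_integral_distr) auto
  show "(\<integral>\<^sup>+z. f (snd z) \<partial>\<pi>) = (\<integral>\<^sup>+x. f x \<partial>\<nu>)"
    unfolding couplingD(4)[OF assms(1), symmetric] using assms(2)
    by (subst nn_integral_distr) auto
qed

lemma coupling_AE:
  assumes "\<pi> \<in> couplings \<mu> \<nu>"
  shows "(AE x in \<mu>. P x) \<Longrightarrow> (AE z in \<pi>. P (fst z))"
    and "(AE x in \<nu>. P x) \<Longrightarrow> (AE z in \<pi>. P (snd z))"
proof -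
  note [measurable_cong] = couplingD(2)[OF assms]
  show "AE z in \<pi>. P (fst z)" if "AE x in \<mu>. P x"
    using that unfolding couplingD(3)[OF assms, symmetric] by (rule AE_distrD[rotated]) simp
  show "AE z in \<pi>. P (snd z)" if "AE x in \<nu>. P x"
    using that unfolding couplingD(4)[OF assms, symmetric] by (rule AE_distrD[rotated]) simp
qed

text \<open>Guarantees that the infimum defining \<open>W2\<close> is not taken over an empty
  set.\<close>

lemma product_coupling:
  assumes "\<mu> \<in> P2" "\<nu> \<in> P2"
  shows "\<mu> \<Otimes>\<^sub>M \<nu> \<in> couplings \<mu> \<nu>"
proof -
  interpret M: prob_space \<mu> using assms(1) by (rule prob_space_P2)
  interpret N: prob_space \<nu> using assms(2) by (rule prob_space_P2)
  interpret pair_prob_space \<mu> \<nu> ..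
  have s: "sets \<mu> = sets borel" "sets \<nu> = sets borel" using assms by (auto simp: sets_P2)
  have "distr (\<mu> \<Otimes>\<^sub>M \<nu>) borel fst = distr (\<mu> \<Otimes>\<^sub>M \<nu>) \<mu> fst"
    by (intro distr_cong) (auto simp: s)
  also have "\<dots> = \<mu>" by (rule N.distr_pair_fst)
  moreover have "distr (\<mu> \<Otimes>\<^sub>M \<nu>) borel snd = \<nu>"
  proof (rule measure_eqI)
    fix X assume "X \<in> sets (distr (\<mu> \<Otimes>\<^sub>M \<nu>) borel snd)"
    then have X: "X \<in> sets borel" by simp
    have "snd -` X \<inter> space (\<mu> \<Otimes>\<^sub>M \<nu>) = space \<mu> \<times> X"
      using X sets.sets_into_space[of X \<nu>] by (auto simp: space_pair_measure s)
    then show "emeasure (distr (\<mu> \<Otimes>\<^sub>M \<nu>) borel snd) X = emeasure \<nu> X"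
      using X s by (subst emeasure_distr)
        (auto simp: N.emeasure_pair_measure_Times M.emeasure_space_1 cong: measurable_cong_sets
          intro!: measurable_snd'')
  qed (simp add: s)
  ultimately show ?thesis
    using s prob_space_axioms by (auto simp: couplings_def intro!: sets_pair_measure_cong)
qed

text \<open>The \<open>enn2real\<close> in the definition of \<open>W2\<close> would send an
  infinite infimum to 0. The product coupling has finite cost, so \<open>W2\<close> really is the
  root of the infimum.\<close>

lemma W2_squared_eq_INF:
  fixes \<mu> \<nu> :: "'a::polish_space measure"
  assumes "\<mu> \<in> P2" "\<nu> \<in> P2"
  shows "(INF \<pi>\<in>couplings \<mu> \<nu>. transport_cost \<pi>) = ennreal ((W2 \<mu> \<nu>)\<^sup>2)"
proof -
  fix c :: 'a
  have "(INF \<pi>\<in>couplings \<mu> \<nu>. transport_cost \<pi>) \<le> transport_cost (\<mu> \<Otimes>\<^sub>M \<nu>)"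
    by (intro INF_lower product_coupling assms)
  also have "\<dots> < \<infinity>"
  proof -
    have s [measurable_cong]: "sets \<mu> = sets borel" "sets \<nu> = sets borel"
      using assms by (auto simp: sets_P2)
    have "ennreal ((dist x y)\<^sup>2) \<le> 2 * ennreal ((dist c x)\<^sup>2) + 2 * ennreal ((dist c y)\<^sup>2)" for x y
    proof -
      have "(dist x y)\<^sup>2 \<le> (dist c x + dist c y)\<^sup>2"
        by (intro power_mono dist_triangle3) auto
      also have "\<dots> \<le> 2 * (dist c x)\<^sup>2 + 2 * (dist c y)\<^sup>2"
        using sum_squares_bound[of "dist c x" "dist c y"] by (simp add: power2_sum)
      finally have "ennreal ((dist x y)\<^sup>2) \<le> ennreal (2 * (dist c x)\<^sup>2 + 2 * (dist c y)\<^sup>2)"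
        by (rule ennreal_leI)
      then show ?thesis by (simp add: ennreal_plus ennreal_mult)
    qed
    then have "transport_cost (\<mu> \<Otimes>\<^sub>M \<nu>) \<le>
       (\<integral>\<^sup>+z. 2 * ennreal ((dist c (fst z))\<^sup>2) + 2 * ennreal ((dist c (snd z))\<^sup>2) \<partial>(\<mu> \<Otimes>\<^sub>M \<nu>))"
      unfolding transport_cost_def by (intro nn_integral_mono)
    also have "\<dots> = 2 * (\<integral>\<^sup>+z. ennreal ((dist c (fst z))\<^sup>2) \<partial>(\<mu> \<Otimes>\<^sub>M \<nu>))
       + 2 * (\<integral>\<^sup>+z. ennreal ((dist c (snd z))\<^sup>2) \<partial>(\<mu> \<Otimes>\<^sub>M \<nu>))"
      by (subst nn_integral_add) (auto simp: nn_integral_cmult)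
    also have "(\<integral>\<^sup>+z. ennreal ((dist c (fst z))\<^sup>2) \<partial>(\<mu> \<Otimes>\<^sub>M \<nu>)) = (\<integral>\<^sup>+x. ennreal ((dist c x)\<^sup>2) \<partial>\<mu>)"
      by (rule coupling_nn_integral(1)[OF product_coupling[OF assms]]) simp
    also have "(\<integral>\<^sup>+z. ennreal ((dist c (snd z))\<^sup>2) \<partial>(\<mu> \<Otimes>\<^sub>M \<nu>)) = (\<integral>\<^sup>+x. ennreal ((dist c x)\<^sup>2) \<partial>\<nu>)"
      by (rule coupling_nn_integral(2)[OF product_coupling[OF assms]]) simp
    finally show ?thesis
      using P2_second_moment[OF assms(1), of c] P2_second_moment[OF assms(2), of c]
      by (auto simp: ennreal_mult_less_top order_le_less_trans)
  qed
  finally show ?thesis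
    by (simp add: W2_def)
qed

lemma W2_le_cost:
  fixes \<mu> \<nu> :: "'a::polish_space measure"
  assumes "\<mu> \<in> P2" "\<nu> \<in> P2" "\<pi> \<in> couplings \<mu> \<nu>"
  shows "ennreal ((W2 \<mu> \<nu>)\<^sup>2) \<le> transport_cost \<pi>"
  unfolding W2_squared_eq_INF[OF assms(1,2), symmetric] by (rule INF_lower) fact

lemma near_optimal_coupling:
  fixes \<mu> \<nu> :: "'a::polish_space measure"
  assumes "\<mu> \<in> P2" "\<nu> \<in> P2" "\<eta> > 0"
  obtains \<pi> where "\<pi> \<in> couplings \<mu> \<nu>" "transport_cost \<pi> \<le> ennreal ((W2 \<mu> \<nu>)\<^sup>2 + \<eta>)"
proof -
  have "(INF \<pi>\<in>couplings \<mu> \<nu>. transport_cost \<pi>) < ennreal ((W2 \<mu> \<nu>)\<^sup>2 + \<eta>)"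
    unfolding W2_squared_eq_INF[OF assms(1,2)] using assms(3)
    by (intro ennreal_lessI) (auto intro: add_nonneg_pos)
  then show ?thesis unfolding INF_less_iff using that by (auto intro: less_imp_le)
qed

section \<open>Approximate gluing of couplings\<close>

text \<open>The index of \<open>x\<close> is that of the first point of a dense sequence within
  \<delta>/2 of \<open>x\<close>, so points with equal index are both within \<delta>/2 of one
  point.\<close>

lemma countable_cells:
  fixes \<delta> :: real
  assumes "\<delta> > 0"
  obtains i :: "'a::{metric_space, second_countable_topology} \<Rightarrow> nat"
  where "i \<in> borel \<rightarrow>\<^sub>M count_space UNIV" "\<And>x y. i x = i y \<Longrightarrow> dist x y \<le> \<delta>"
proof -
  obtain D :: "'a set" where D: "countable D" "\<And>X. open X \<Longrightarrow> X \<noteq> {} \<Longrightarrow> \<exists>d\<in>D. d \<in> X"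
    using countable_dense_exists by (metis (no_types, lifting))
  have "D \<noteq> {}" using D(2)[of UNIV] by auto
  define e where "e = from_nat_into D"
  have ex: "\<exists>k. dist (e k) x < \<delta>/2" for x
  proof -
    obtain d where "d \<in> D" "d \<in> ball x (\<delta>/2)" using D(2)[of "ball x (\<delta>/2)"] assms by auto
    then show ?thesis using from_nat_into_surj[OF D(1)] unfolding e_def
      by (metis dist_commute mem_ball)
  qed
  define i where "i x = (LEAST k. dist (e k) x < \<delta>/2)" for x
  have "i \<in> borel \<rightarrow>\<^sub>M count_space UNIV" unfolding i_def by measurable
  moreover have "dist x y \<le> \<delta>" if "i x = i y" for x y
  proof -
    have "dist (e (i x)) x < \<delta>/2" "dist (e (i y)) y < \<delta>/2"
      unfolding i_def by (rule LeastI_ex[OF ex])+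
    then show ?thesis using that dist_triangle3[of x y "e (i x)"] by simp
  qed
  ultimately show ?thesis by (rule that)
qed

text \<open>Gluing only up to \<open>\<delta>\<close>, along countably many cells of diameter at most \<open>\<delta>\<close>, makes
  disintegration of the couplings unnecessary.\<close>
lemma gluing:
  fixes \<pi>\<^sub>1 \<pi>\<^sub>2 :: "('a::polish_space \<times> 'a) measure"
  assumes c1: "\<pi>\<^sub>1 \<in> couplings \<mu> \<nu>" and c2: "\<pi>\<^sub>2 \<in> couplings \<nu> \<xi>"
    and \<nu>: "\<nu> \<in> P2" and "\<delta> > 0"
  obtains G :: "(('a \<times> 'a) \<times> ('a \<times> 'a)) measure"
  where "sets G = sets (\<pi>\<^sub>1 \<Otimes>\<^sub>M \<pi>\<^sub>2)" "distr G \<pi>\<^sub>1 fst = \<pi>\<^sub>1" "distr G \<pi>\<^sub>2 snd = \<pi>\<^sub>2"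
    "AE w in G. dist (snd (fst w)) (fst (snd w)) \<le> \<delta>"
proof -
  interpret p1: prob_space \<pi>\<^sub>1 by (rule couplingD(1)[OF c1])
  interpret p2: prob_space \<pi>\<^sub>2 by (rule couplingD(1)[OF c2])
  interpret P: pair_prob_space \<pi>\<^sub>1 \<pi>\<^sub>2 ..
  interpret v: prob_space \<nu> by (rule prob_space_P2) fact
  note [measurable_cong] = couplingD(2)[OF c1] couplingD(2)[OF c2] sets_P2[OF \<nu>]
  obtain i :: "'a \<Rightarrow> nat" where i [measurable]: "i \<in> borel \<rightarrow>\<^sub>M count_space UNIV"
    and i_dist: "\<And>x y. i x = i y \<Longrightarrow> dist x y \<le> \<delta>"
    using countable_cells[OF \<open>\<delta> > 0\<close>] by blast
  define q where "q k = emeasure \<nu> {z\<in>space \<nu>. i z = k}" for k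
  \<comment> \<open>With this density the two couplings are independent once the cell of the middle
    point is fixed; dividing by the mass of the cell preserves the marginals.\<close>
  define h where "h w = (if i (snd (fst w)) = i (fst (snd w)) then inverse (q (i (snd (fst w)))) else 0)"
    for w :: "('a \<times> 'a) \<times> ('a \<times> 'a)"
  have qi: "(\<lambda>x. q (i x)) \<in> borel_measurable borel" by (rule measurable_compose[OF i]) simp
  have [measurable]: "h \<in> borel_measurable (\<pi>\<^sub>1 \<Otimes>\<^sub>M \<pi>\<^sub>2)"
  proof -
    \<comment> \<open>Equality of the two indices is written as a countable union over their common
      value, a form from which its measurability can be derived automatically.\<close>
    let ?I = "\<lambda>w::('a \<times> 'a) \<times> ('a \<times> 'a). \<exists>k. i (snd (fst w)) = k \<and> i (fst (snd w)) = k"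
    have "h w = (if ?I w then inverse (q (i (snd (fst w)))) else 0)" for w by (simp add: h_def)
    moreover have "Measurable.pred (\<pi>\<^sub>1 \<Otimes>\<^sub>M \<pi>\<^sub>2) ?I" by measurable
    moreover have "(\<lambda>w. inverse (q (i (snd (fst w))))) \<in> borel_measurable (\<pi>\<^sub>1 \<Otimes>\<^sub>M \<pi>\<^sub>2)"
      by (intro borel_measurable_inverse_ennreal measurable_compose[OF _ qi]) measurable
    ultimately show ?thesis by (subst measurable_cong) (auto intro!: measurable_If)
  qed
  have q_fin: "q k \<noteq> \<infinity>" for k unfolding q_def by simp
  \<comment> \<open>In a cell of mass 0 the quotient \<open>q k / q k\<close> is 0 instead of 1.
    There are countably many such cells, so together they form a null set.\<close>
  have "AE z in \<nu>. i z = k \<longrightarrow> q k \<noteq> 0" for k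
  proof (cases "q k = 0")
    case True
    then have "AE z in \<nu>. i z \<noteq> k"
      unfolding q_def by (subst AE_iff_measurable[of "{z\<in>space \<nu>. i z = k}"]) auto
    then show ?thesis by eventually_elim simp
  qed auto
  then have "AE z in \<nu>. \<forall>k. i z = k \<longrightarrow> q k \<noteq> 0" by (subst AE_all_countable) auto
  then have q_pos: "AE z in \<nu>. q (i z) \<noteq> 0" by simp
  define G where "G = density (\<pi>\<^sub>1 \<Otimes>\<^sub>M \<pi>\<^sub>2) h"
  \<comment> \<open>Only the first marginal of \<open>\<pi>\<^sub>2\<close> enters, and this is the
    shared measure \<open>\<nu>\<close>.\<close>
  have m1: "(\<integral>\<^sup>+b. h (a, b) \<partial>\<pi>\<^sub>2) = q (i (snd a)) / q (i (snd a))" for a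
  proof -
    have "(\<integral>\<^sup>+b. h (a, b) \<partial>\<pi>\<^sub>2) = (\<integral>\<^sup>+b. inverse (q (i (snd a))) * indicator {z. i z = i (snd a)} (fst b) \<partial>\<pi>\<^sub>2)"
      by (intro nn_integral_cong) (auto simp: h_def)
    also have "\<dots> = (\<integral>\<^sup>+z. inverse (q (i (snd a))) * indicator {z. i z = i (snd a)} z \<partial>\<nu>)"
      by (rule coupling_nn_integral(1)[OF c2]) measurable
    also have "\<dots> = inverse (q (i (snd a))) * q (i (snd a))"
      using sets_P2[OF \<nu>] sets_eq_imp_space_eq[OF sets_P2[OF \<nu>]]
      by (subst nn_integral_cmult_indicator) (auto simp: q_def)
    finally show ?thesis by (simp add: divide_ennreal_def mult.commute)
  qed
  have m2: "(\<integral>\<^sup>+a. h (a, b) \<partial>\<pi>\<^sub>1) = q (i (fst b)) / q (i (fst b))" for b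
  proof -
    have "(\<integral>\<^sup>+a. h (a, b) \<partial>\<pi>\<^sub>1) = (\<integral>\<^sup>+a. inverse (q (i (fst b))) * indicator {z. i z = i (fst b)} (snd a) \<partial>\<pi>\<^sub>1)"
      by (intro nn_integral_cong) (auto simp: h_def)
    also have "\<dots> = (\<integral>\<^sup>+z. inverse (q (i (fst b))) * indicator {z. i z = i (fst b)} z \<partial>\<nu>)"
      by (rule coupling_nn_integral(2)[OF c1]) measurable
    also have "\<dots> = inverse (q (i (fst b))) * q (i (fst b))"
      using sets_P2[OF \<nu>] sets_eq_imp_space_eq[OF sets_P2[OF \<nu>]]
      by (subst nn_integral_cmult_indicator) (auto simp: q_def)
    finally show ?thesis by (simp add: divide_ennreal_def mult.commute)
  qed
  have "distr G \<pi>\<^sub>1 fst = \<pi>\<^sub>1"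
  proof (rule measure_eqI)
    fix X assume "X \<in> sets (distr G \<pi>\<^sub>1 fst)"
    then have X [measurable]: "X \<in> sets \<pi>\<^sub>1" by simp
    have "emeasure (distr G \<pi>\<^sub>1 fst) X = (\<integral>\<^sup>+w. indicator X w \<partial>distr G \<pi>\<^sub>1 fst)"
      using X by simp
    also have "\<dots> = (\<integral>\<^sup>+w. h w * indicator X (fst w) \<partial>(\<pi>\<^sub>1 \<Otimes>\<^sub>M \<pi>\<^sub>2))"
      unfolding G_def by (subst nn_integral_distr) (auto simp: nn_integral_density)
    also have "\<dots> = (\<integral>\<^sup>+a. \<integral>\<^sup>+b. h (a, b) * indicator X a \<partial>\<pi>\<^sub>2 \<partial>\<pi>\<^sub>1)"
      by (subst p2.nn_integral_fst[symmetric]) auto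
    also have "\<dots> = (\<integral>\<^sup>+a. (q (i (snd a)) / q (i (snd a))) * indicator X a \<partial>\<pi>\<^sub>1)"
      by (intro nn_integral_cong, subst nn_integral_multc) (auto simp: m1)
    also have "\<dots> = (\<integral>\<^sup>+a. indicator X a \<partial>\<pi>\<^sub>1)"
      using coupling_AE(2)[OF c1 q_pos] q_fin
      by (intro nn_integral_cong_AE) (auto simp: top_unique less_top)
    finally show "emeasure (distr G \<pi>\<^sub>1 fst) X = emeasure \<pi>\<^sub>1 X" using X by simp
  qed simp
  moreover have "distr G \<pi>\<^sub>2 snd = \<pi>\<^sub>2"
  proof (rule measure_eqI)
    fix X assume "X \<in> sets (distr G \<pi>\<^sub>2 snd)"
    then have X [measurable]: "X \<in> sets \<pi>\<^sub>2" by simp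
    have "emeasure (distr G \<pi>\<^sub>2 snd) X = (\<integral>\<^sup>+w. indicator X w \<partial>distr G \<pi>\<^sub>2 snd)"
      using X by simp
    also have "\<dots> = (\<integral>\<^sup>+w. h w * indicator X (snd w) \<partial>(\<pi>\<^sub>1 \<Otimes>\<^sub>M \<pi>\<^sub>2))"
      unfolding G_def by (subst nn_integral_distr) (auto simp: nn_integral_density)
    also have "\<dots> = (\<integral>\<^sup>+b. \<integral>\<^sup>+a. h (a, b) * indicator X b \<partial>\<pi>\<^sub>1 \<partial>\<pi>\<^sub>2)"
      by (subst P.nn_integral_snd[symmetric]) auto
    also have "\<dots> = (\<integral>\<^sup>+b. (q (i (fst b)) / q (i (fst b))) * indicator X b \<partial>\<pi>\<^sub>2)"
      by (intro nn_integral_cong, subst nn_integral_multc) (auto simp: m2)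
    also have "\<dots> = (\<integral>\<^sup>+b. indicator X b \<partial>\<pi>\<^sub>2)"
      using coupling_AE(1)[OF c2 q_pos] q_fin
      by (intro nn_integral_cong_AE) (auto simp: top_unique less_top)
    finally show "emeasure (distr G \<pi>\<^sub>2 snd) X = emeasure \<pi>\<^sub>2 X" using X by simp
  qed simp
  moreover have "AE w in G. dist (snd (fst w)) (fst (snd w)) \<le> \<delta>"
    unfolding G_def by (subst AE_density) (auto simp: h_def i_dist)
  ultimately show ?thesis by (intro that[of G]) (auto simp: G_def)
qed

section \<open>Localization of Wasserstein geodesics\<close>

text \<open>Here \<open>a\<close>, \<open>b\<close> and \<open>D\<close> stand for the distances from start to intermediate point, from
  intermediate point to end, and from start to end; \<open>a + b\<close> is bounded below by expanding both
  squares around \<open>t D\<close> and \<open>(1 - t) D\<close>. The extra term detects mass transported too far.\<close>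
lemma geodesic_pointwise:
  fixes a b D \<delta> t T k :: real
  assumes "0 < t" "t < 1" "0 \<le> D" "D \<le> T" "D \<le> a + b + \<delta>" "0 \<le> \<delta>" "0 \<le> k"
  shows "D\<^sup>2 + k\<^sup>2 * (if (1 - t) * T + k \<le> b then 1 else 0) \<le> a\<^sup>2 / t + b\<^sup>2 / (1 - t) + 2 * T * \<delta>"
proof -
  have "a\<^sup>2 / t - (2 * D * a - t * D\<^sup>2) = (a - t * D)\<^sup>2 / t"
    using assms by (simp add: field_simps power2_eq_square)
  then have 1: "a\<^sup>2 / t \<ge> 2 * D * a - t * D\<^sup>2" using assms by (smt (verit) divide_nonneg_pos zero_le_power2)
  have 2: "b\<^sup>2 / (1 - t) = 2 * D * b - (1 - t) * D\<^sup>2 + (b - (1 - t) * D)\<^sup>2 / (1 - t)"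
    using assms by (simp add: field_simps power2_eq_square)
  have 3: "k\<^sup>2 * (if (1 - t) * T + k \<le> b then 1 else 0) \<le> (b - (1 - t) * D)\<^sup>2 / (1 - t)"
  proof (cases "(1 - t) * T + k \<le> b")
    case True
    have "(1 - t) * D \<le> (1 - t) * T" using assms by (intro mult_left_mono) auto
    then have "k \<le> b - (1 - t) * D" using True by linarith
    then have "k\<^sup>2 \<le> (b - (1 - t) * D)\<^sup>2" using assms by (intro power_mono)
    also have "\<dots> \<le> (b - (1 - t) * D)\<^sup>2 / (1 - t)" using assms by (simp add: le_divide_eq mult_left_le)
    finally show ?thesis using True by simp
  qed (use assms in auto)
  have "D * (D - \<delta>) \<le> D * (a + b)" using assms by (intro mult_left_mono) auto
  moreover have "D * \<delta> \<le> T * \<delta>" using assms by (intro mult_right_mono) auto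
  ultimately show ?thesis using 1 2 3 by (simp add: algebra_simps power2_eq_square)
qed


text \<open>Glue almost optimal couplings from \<open>\<mu>\<close> to \<open>\<Gamma> t\<close> and
  from there to \<open>\<nu>\<close>, and integrate \<open>geodesic_pointwise\<close>. The resulting
  coupling of \<open>\<mu>\<close> and \<open>\<nu>\<close> costs at least \<open>W\<close>, which
  leaves no room for mass too far out. The radius arises because mass travels at most R + r in
  total, a fraction 1 - t of this remains at time t, and the end point is within r of
  \<open>c\<close>.\<close>

lemma geodesic_localized:
  fixes \<Gamma> :: "real \<Rightarrow> 'a::polish_space measure"
  assumes geo: "W2_geodesic X \<mu> \<nu> \<Gamma>" and X: "X \<subseteq> P2"
    and t: "0 < t" "t < 1" and R: "0 \<le> R" and r: "0 \<le> r"
    and \<mu>: "AE x in \<mu>. dist c x \<le> R" and \<nu>: "AE y in \<nu>. dist c y \<le> r"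
  shows "AE z in \<Gamma> t. dist c z \<le> (1 - t) * (R + r) + r"
proof -
  define T where "T = R + r"
  define W where "W = (W2 \<mu> \<nu>)\<^sup>2"
  have tI: "t \<in> {0..1}" and P: "\<mu> \<in> P2" "\<nu> \<in> P2" "\<Gamma> t \<in> P2"
    and d0: "(W2 \<mu> (\<Gamma> t))\<^sup>2 = t\<^sup>2 * W" and d1: "(W2 (\<Gamma> t) \<nu>)\<^sup>2 = (1 - t)\<^sup>2 * W"
  proof -
    show tI: "t \<in> {0..1}" using t by auto
    have "\<forall>s\<in>{0..1}. \<Gamma> s \<in> X" and e: "\<Gamma> 0 = \<mu>" "\<Gamma> 1 = \<nu>"
      and d: "\<forall>s\<in>{0..1}. \<forall>t\<in>{0..1}. W2 (\<Gamma> s) (\<Gamma> t) = \<bar>s - t\<bar> * W2 \<mu> \<nu>"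
      using geo unfolding W2_geodesic_def by auto
    then show "\<mu> \<in> P2" "\<nu> \<in> P2" "\<Gamma> t \<in> P2" using X tI by force+
    show "(W2 \<mu> (\<Gamma> t))\<^sup>2 = t\<^sup>2 * W" using d[rule_format, of 0 t] e tI
      by (simp add: W_def power_mult_distrib)
    show "(W2 (\<Gamma> t) \<nu>)\<^sup>2 = (1 - t)\<^sup>2 * W" using d[rule_format, of t 1] e tI
      by (simp add: W_def power_mult_distrib power2_commute)
  qed
  have T0: "0 \<le> T" using R r by (simp add: T_def)
  have W0: "0 \<le> W" by (simp add: W_def)
  interpret g: prob_space "\<Gamma> t" by (rule prob_space_P2) fact
  have sg: "sets (\<Gamma> t) = sets borel" by (rule sets_P2) fact
  note [measurable_cong] = sg
  \<comment> \<open>Of the margin 2 k, one k absorbs the gluing error \<eta> and the other is the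
    excess detected by \<open>geodesic_pointwise\<close>.\<close>
  have main: "k\<^sup>2 * g.prob {z. (1 - t) * T + r + 2 * k \<le> dist c z} \<le> \<eta> * (1 / t + 1 / (1 - t) + 2 * T)"
    if k: "0 < k" and \<eta>: "0 < \<eta>" "\<eta> \<le> k" for k \<eta>
  proof -
    obtain \<pi>\<^sub>1 where c1: "\<pi>\<^sub>1 \<in> couplings \<mu> (\<Gamma> t)" "transport_cost \<pi>\<^sub>1 \<le> ennreal (t\<^sup>2 * W + \<eta>)"
      using near_optimal_coupling[OF P(1,3) \<eta>(1)] unfolding d0 by blast
    obtain \<pi>\<^sub>2 where c2: "\<pi>\<^sub>2 \<in> couplings (\<Gamma> t) \<nu>" "transport_cost \<pi>\<^sub>2 \<le> ennreal ((1 - t)\<^sup>2 * W + \<eta>)"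
      using near_optimal_coupling[OF P(3,2) \<eta>(1)] unfolding d1 by blast
    obtain G :: "(('a \<times> 'a) \<times> ('a \<times> 'a)) measure"
      where sG: "sets G = sets (\<pi>\<^sub>1 \<Otimes>\<^sub>M \<pi>\<^sub>2)" and G1: "distr G \<pi>\<^sub>1 fst = \<pi>\<^sub>1" and G2: "distr G \<pi>\<^sub>2 snd = \<pi>\<^sub>2"
      and Gd: "AE w in G. dist (snd (fst w)) (fst (snd w)) \<le> \<eta>"
      using gluing[OF c1(1) c2(1) P(3) \<eta>(1)] by blast
    note [measurable_cong] = couplingD(2)[OF c1(1)] couplingD(2)[OF c2(1)]
    have [measurable_cong]: "sets G = sets ((borel \<Otimes>\<^sub>M borel) \<Otimes>\<^sub>M (borel \<Otimes>\<^sub>M borel))"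
      unfolding sG by (intro sets_pair_measure_cong couplingD(2)[OF c1(1)] couplingD(2)[OF c2(1)])
    have i1: "(\<integral>\<^sup>+w. f (fst w) \<partial>G) = (\<integral>\<^sup>+z. f z \<partial>\<pi>\<^sub>1)" if [measurable]: "f \<in> borel_measurable (borel \<Otimes>\<^sub>M borel)" for f
    proof -
      have "(\<integral>\<^sup>+z. f z \<partial>distr G \<pi>\<^sub>1 fst) = (\<integral>\<^sup>+w. f (fst w) \<partial>G)" by (subst nn_integral_distr) auto
      then show ?thesis unfolding G1 by simp
    qed
    have i2: "(\<integral>\<^sup>+w. f (snd w) \<partial>G) = (\<integral>\<^sup>+z. f z \<partial>\<pi>\<^sub>2)" if [measurable]: "f \<in> borel_measurable (borel \<Otimes>\<^sub>M borel)" for f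
    proof -
      have "(\<integral>\<^sup>+z. f z \<partial>distr G \<pi>\<^sub>2 snd) = (\<integral>\<^sup>+w. f (snd w) \<partial>G)" by (subst nn_integral_distr) auto
      then show ?thesis unfolding G2 by simp
    qed
    have a1: "AE w in G. Q (fst w)" if "AE z in \<pi>\<^sub>1. Q z" for Q
    proof -
      have "AE z in distr G \<pi>\<^sub>1 fst. Q z" unfolding G1 by (rule that)
      then show ?thesis by (rule AE_distrD[rotated]) measurable
    qed
    have a2: "AE w in G. Q (snd w)" if "AE z in \<pi>\<^sub>2. Q z" for Q
    proof -
      have "AE z in distr G \<pi>\<^sub>2 snd. Q z" unfolding G2 by (rule that)
      then show ?thesis by (rule AE_distrD[rotated]) measurable
    qed
    interpret p1: prob_space \<pi>\<^sub>1 by (rule couplingD(1)[OF c1(1)])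
    have "prob_space (distr G \<pi>\<^sub>1 fst)" unfolding G1 by (rule p1.prob_space_axioms)
    then interpret G: prob_space G by (rule prob_space_distrD[rotated]) measurable
    define a where "a w = dist (fst (fst w)) (snd (fst w))" for w :: "('a \<times> 'a) \<times> ('a \<times> 'a)"
    define b where "b w = dist (fst (snd w)) (snd (snd w))" for w :: "('a \<times> 'a) \<times> ('a \<times> 'a)"
    define D where "D w = dist (fst (fst w)) (snd (snd w))" for w :: "('a \<times> 'a) \<times> ('a \<times> 'a)"
    define B where "B = {z. (1 - t) * T + r + 2 * k \<le> dist c z}"
    have [measurable]: "a \<in> borel_measurable G" "b \<in> borel_measurable G" "D \<in> borel_measurable G"
      unfolding a_def b_def D_def by measurable
    have [measurable]: "B \<in> sets borel" unfolding B_def by measurable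
    have aI: "(\<integral>\<^sup>+w. ennreal ((a w)\<^sup>2) \<partial>G) \<le> ennreal (t\<^sup>2 * W + \<eta>)"
      using c1(2) unfolding transport_cost_def a_def by (subst i1) auto
    have bI: "(\<integral>\<^sup>+w. ennreal ((b w)\<^sup>2) \<partial>G) \<le> ennreal ((1 - t)\<^sup>2 * W + \<eta>)"
      using c2(2) unfolding transport_cost_def b_def by (subst i2) auto
    \<comment> \<open>Forgetting the two middle points of \<open>G\<close> leaves a coupling of
      \<open>\<mu>\<close> and \<open>\<nu>\<close>, so its cost is at least
      \<open>W\<close>.\<close>
    have DI: "ennreal W \<le> (\<integral>\<^sup>+w. ennreal ((D w)\<^sup>2) \<partial>G)"
    proof -
      define \<pi> where "\<pi> = distr G (borel \<Otimes>\<^sub>M borel) (\<lambda>w. (fst (fst w), snd (snd w)))"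
      have "distr \<pi> borel fst = distr G borel (\<lambda>w. fst (fst w))"
        unfolding \<pi>_def by (subst distr_distr) (auto simp: comp_def)
      also have "\<dots> = distr (distr G \<pi>\<^sub>1 fst) borel fst"
        by (subst distr_distr) (auto simp: comp_def)
      also have "\<dots> = \<mu>" unfolding G1 by (rule couplingD(3)[OF c1(1)])
      finally have e1: "distr \<pi> borel fst = \<mu>" .
      have "distr \<pi> borel snd = distr G borel (\<lambda>w. snd (snd w))"
        unfolding \<pi>_def by (subst distr_distr) (auto simp: comp_def)
      also have "\<dots> = distr (distr G \<pi>\<^sub>2 snd) borel snd"
        by (subst distr_distr) (auto simp: comp_def)
      also have "\<dots> = \<nu>" unfolding G2 by (rule couplingD(4)[OF c2(1)])
      finally have e2: "distr \<pi> borel snd = \<nu>" .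
      have "\<pi> \<in> couplings \<mu> \<nu>"
        unfolding couplings_def using e1 e2 by (auto simp: \<pi>_def intro!: G.prob_space_distr)
      from W2_le_cost[OF P(1,2) this] show ?thesis
        unfolding W_def transport_cost_def D_def \<pi>_def by (subst (asm) nn_integral_distr) auto
    qed
    have GB: "emeasure (\<Gamma> t) B = (\<integral>\<^sup>+w. indicator B (snd (fst w)) \<partial>G)"
    proof -
      have "emeasure (\<Gamma> t) B = (\<integral>\<^sup>+z. indicator B z \<partial>\<Gamma> t)" by (simp add: sg)
      also have "\<dots> = (\<integral>\<^sup>+z. indicator B (snd z) \<partial>\<pi>\<^sub>1)"
        by (rule coupling_nn_integral(2)[OF c1(1), symmetric]) simp
      also have "\<dots> = (\<integral>\<^sup>+w. indicator B (snd (fst w)) \<partial>G)"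
        by (rule i1[symmetric]) measurable
      finally show ?thesis .
    qed
    have "AE w in G. ennreal ((D w)\<^sup>2) + ennreal (k\<^sup>2) * indicator B (snd (fst w))
        \<le> ennreal (1 / t) * ennreal ((a w)\<^sup>2) + ennreal (1 / (1 - t)) * ennreal ((b w)\<^sup>2) + ennreal (2 * T * \<eta>)"
      using Gd a1[OF coupling_AE(1)[OF c1(1) \<mu>]] a2[OF coupling_AE(2)[OF c2(1) \<nu>]]
    proof eventually_elim
      fix w :: "('a \<times> 'a) \<times> ('a \<times> 'a)"
      assume w: "dist (snd (fst w)) (fst (snd w)) \<le> \<eta>" "dist c (fst (fst w)) \<le> R" "dist c (snd (snd w)) \<le> r"
      have "D w \<le> T" using w dist_triangle3[of "fst (fst w)" "snd (snd w)" c] by (simp add: D_def T_def)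
      moreover have "D w \<le> a w + b w + \<eta>"
        using w dist_triangle[of "fst (fst w)" "snd (snd w)" "snd (fst w)"]
          dist_triangle[of "snd (fst w)" "snd (snd w)" "fst (snd w)"] by (simp add: D_def a_def b_def)
      ultimately have pt: "(D w)\<^sup>2 + k\<^sup>2 * (if (1 - t) * T + k \<le> b w then 1 else 0)
           \<le> (a w)\<^sup>2 / t + (b w)\<^sup>2 / (1 - t) + 2 * T * \<eta>"
        using t \<eta> k by (intro geodesic_pointwise) (auto simp: D_def)
      have "indicat_real B (snd (fst w)) \<le> (if (1 - t) * T + k \<le> b w then 1 else 0)"
        using w dist_triangle[of c "snd (fst w)" "snd (snd w)"] dist_triangle[of "snd (snd w)" "snd (fst w)" "fst (snd w)"]
          \<eta> by (auto simp: B_def b_def dist_commute indicator_def)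
      then have "(D w)\<^sup>2 + k\<^sup>2 * indicat_real B (snd (fst w)) \<le> (a w)\<^sup>2 / t + (b w)\<^sup>2 / (1 - t) + 2 * T * \<eta>"
        by (intro order_trans[OF _ pt] add_left_mono mult_left_mono) auto
      then have "ennreal ((D w)\<^sup>2 + k\<^sup>2 * indicat_real B (snd (fst w)))
          \<le> ennreal (1 / t * (a w)\<^sup>2 + 1 / (1 - t) * (b w)\<^sup>2 + 2 * T * \<eta>)"
        by (intro ennreal_leI) simp
      then show "ennreal ((D w)\<^sup>2) + ennreal (k\<^sup>2) * indicator B (snd (fst w))
        \<le> ennreal (1 / t) * ennreal ((a w)\<^sup>2) + ennreal (1 / (1 - t)) * ennreal ((b w)\<^sup>2) + ennreal (2 * T * \<eta>)"
        using t T0 \<eta> by (simp only: ennreal_plus ennreal_mult ennreal_indicator zero_le_power2 mult_nonneg_nonneg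
            indicator_pos_le zero_le_divide_1_iff less_imp_le add_nonneg_nonneg diff_ge_0_iff_ge zero_le_numeral)
    qed
    then have "(\<integral>\<^sup>+w. ennreal ((D w)\<^sup>2) + ennreal (k\<^sup>2) * indicator B (snd (fst w)) \<partial>G)
       \<le> (\<integral>\<^sup>+w. ennreal (1 / t) * ennreal ((a w)\<^sup>2) + ennreal (1 / (1 - t)) * ennreal ((b w)\<^sup>2) + ennreal (2 * T * \<eta>) \<partial>G)"
      by (rule nn_integral_mono_AE)
    also have "\<dots> = ennreal (1 / t) * (\<integral>\<^sup>+w. ennreal ((a w)\<^sup>2) \<partial>G)
        + ennreal (1 / (1 - t)) * (\<integral>\<^sup>+w. ennreal ((b w)\<^sup>2) \<partial>G) + ennreal (2 * T * \<eta>)"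
      by (simp add: nn_integral_add nn_integral_cmult G.emeasure_space_1)
    also have "\<dots> \<le> ennreal (1 / t) * ennreal (t\<^sup>2 * W + \<eta>)
        + ennreal (1 / (1 - t)) * ennreal ((1 - t)\<^sup>2 * W + \<eta>) + ennreal (2 * T * \<eta>)"
      by (intro add_right_mono add_mono mult_left_mono aI bI) auto
    also have "\<dots> = ennreal (1 / t * (t\<^sup>2 * W + \<eta>) + 1 / (1 - t) * ((1 - t)\<^sup>2 * W + \<eta>) + 2 * T * \<eta>)"
      using t \<eta> T0 W0 by (simp add: ennreal_mult[symmetric] ennreal_plus[symmetric] del: ennreal_plus)
    \<comment> \<open>On a geodesic the two squared distances are t^2 W and (1 - t)^2 W; the weights
      1/t and 1/(1 - t) make them add up to exactly W, and only terms of order \<eta> are left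
      over.\<close>
    also have "1 / t * (t\<^sup>2 * W + \<eta>) + 1 / (1 - t) * ((1 - t)\<^sup>2 * W + \<eta>) + 2 * T * \<eta>
        = W + \<eta> * (1 / t + 1 / (1 - t) + 2 * T)"
      using t by (simp add: field_simps power2_eq_square)
    also have "(\<integral>\<^sup>+w. ennreal ((D w)\<^sup>2) + ennreal (k\<^sup>2) * indicator B (snd (fst w)) \<partial>G)
        = (\<integral>\<^sup>+w. ennreal ((D w)\<^sup>2) \<partial>G) + ennreal (k\<^sup>2) * emeasure (\<Gamma> t) B"
      unfolding GB by (subst nn_integral_add) (auto simp: nn_integral_cmult)
    finally have "ennreal W + ennreal (k\<^sup>2) * emeasure (\<Gamma> t) B \<le> ennreal (W + \<eta> * (1 / t + 1 / (1 - t) + 2 * T))"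
      using DI by (meson add_right_mono order_trans)
    then have "ennreal (W + k\<^sup>2 * g.prob B) \<le> ennreal (W + \<eta> * (1 / t + 1 / (1 - t) + 2 * T))"
      using W0 by (simp add: g.emeasure_eq_measure ennreal_mult)
    then show ?thesis
      using t \<eta> T0 W0 by (subst (asm) ennreal_le_iff) (auto simp: B_def)
  qed
  have null: "g.prob {z. (1 - t) * T + r + 2 * k \<le> dist c z} = 0" if k: "0 < k" for k
  proof (rule ccontr)
    let ?p = "g.prob {z. (1 - t) * T + r + 2 * k \<le> dist c z}"
    let ?c = "1 / t + 1 / (1 - t) + 2 * T"
    assume "?p \<noteq> 0"
    then have p: "k\<^sup>2 * ?p > 0" using k by (simp add: zero_less_measure_iff)
    have c: "?c > 0" using t T0 by (intro add_pos_nonneg) auto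
    \<comment> \<open>With this choice the right-hand side of \<open>main\<close> is at most half of
      its left-hand side.\<close>
    define \<eta> where "\<eta> = min k (k\<^sup>2 * ?p / (2 * ?c))"
    have "\<eta> > 0" "\<eta> \<le> k" using p c k by (auto simp: \<eta>_def)
    from main[OF k this] have "k\<^sup>2 * ?p \<le> \<eta> * ?c" .
    also have "\<dots> \<le> k\<^sup>2 * ?p / (2 * ?c) * ?c"
      using c by (intro mult_right_mono) (auto simp: \<eta>_def)
    also have "\<dots> = k\<^sup>2 * ?p / 2"
    proof -
      have "x / (2 * y) * y = x / 2" if "y > 0" for x y :: real using that by (simp add: field_simps)
      then show ?thesis using c by blast
    qed
    finally show False using p by simp
  qed
  have "AE z in \<Gamma> t. \<forall>j. dist c z < (1 - t) * T + r + 2 * (1 / real (Suc j))"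
    unfolding AE_all_countable
  proof
    fix j
    have "{z. (1 - t) * T + r + 2 * (1 / real (Suc j)) \<le> dist c z} \<in> null_sets (\<Gamma> t)"
      using null[of "1 / real (Suc j)"] by (intro null_setsI) (auto simp: g.emeasure_eq_measure)
    then show "AE z in \<Gamma> t. dist c z < (1 - t) * T + r + 2 * (1 / real (Suc j))"
      by (rule AE_I') auto
  qed
  then show ?thesis
  proof eventually_elim
    case (elim z)
    have "(\<lambda>j. (1 - t) * T + r + 2 * (1 / real (Suc j))) \<longlonglongrightarrow> (1 - t) * T + r + 2 * 0"
      by (intro tendsto_intros LIMSEQ_Suc[OF lim_1_over_n])
    then have "dist c z \<le> (1 - t) * T + r + 2 * 0"
      by (rule LIMSEQ_le_const) (use elim in \<open>auto intro!: less_imp_le\<close>)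
    then show ?case by (simp add: T_def)
  qed
qed

section \<open>Volume comparison\<close>

locale proper_mms =
  fixes m :: "'a::polish_space measure"
  assumes mms: "metric_measure_space m" and proper: "proper_space TYPE('a)"
begin

lemma sets_m [measurable_cong, simp]: "sets m = sets borel"
  using mms by (simp add: metric_measure_space_def)

lemma space_m [simp]: "space m = UNIV"
  using sets_eq_imp_space_eq[OF sets_m] by simp

lemma emeasure_compact_finite:
  assumes "compact S"
  shows "emeasure m S < \<infinity>"
proof -
  obtain U where U: "\<And>x. open (U x)" "\<And>x. x \<in> U x" "\<And>x. emeasure m (U x) < \<infinity>"
    using mms unfolding metric_measure_space_def locally_finite_measure_def by metis
  obtain F where F: "F \<subseteq> S" "finite F" "S \<subseteq> \<Union>(U ` F)"
    using compactE_image[OF assms, of S U] U(1,2) by blast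
  have "emeasure m S \<le> emeasure m (\<Union>(U ` F))"
    using F U(1) by (intro emeasure_mono) (auto intro!: borel_open)
  also have "\<dots> \<le> (\<Sum>x\<in>F. emeasure m (U x))"
    using F U(1) by (intro emeasure_subadditive_finite) (auto intro!: borel_open)
  also have "\<dots> < \<infinity>" using F U(3) by (auto simp: less_top[symmetric])
  finally show ?thesis .
qed

text \<open>Properness enters here: closures of bounded sets are compact, and local finiteness
  bounds the measure of compact sets.\<close>

lemma emeasure_bounded_finite:
  assumes "bounded S"
  shows "emeasure m S < \<infinity>"
proof -
  have "compact (closure S)" using proper assms by (auto simp: proper_space_def)
  moreover have "emeasure m S \<le> emeasure m (closure S)"
    by (intro emeasure_mono closure_subset) simp
  ultimately show ?thesis using emeasure_compact_finite by (auto intro: order_le_less_trans)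
qed

lemma emeasure_eq_measure_bounded: "bounded S \<Longrightarrow> emeasure m S = ennreal (measure m S)"
  using emeasure_bounded_finite[of S] by (intro emeasure_eq_ennreal_measure) auto

lemma measure_mono_bounded:
  "S \<subseteq> T \<Longrightarrow> S \<in> sets borel \<Longrightarrow> T \<in> sets borel \<Longrightarrow> bounded T \<Longrightarrow> measure m S \<le> measure m T"
  using emeasure_bounded_finite[of T] by (intro measure_mono_fmeasurable) (auto simp: fmeasurable_def)

lemma emeasure_open_pos: "open U \<Longrightarrow> x \<in> U \<Longrightarrow> 0 < emeasure m U"
  using mms by (auto simp: metric_measure_space_def measure_support_def)

lemma measure_ball_pos: "0 < r \<Longrightarrow> 0 < measure m (ball x r)"
  using emeasure_open_pos[of "ball x r" x] by (simp add: emeasure_eq_measure_bounded)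

lemma measure_cball_pos: "0 < r \<Longrightarrow> 0 < measure m (cball x r)"
  using measure_ball_pos[of r x] measure_mono_bounded[of "ball x r" "cball x r"]
  by (simp add: ball_subset_cball)

text \<open>Balls of integer radius exhaust the space. This gives access to Radon-Nikodym
  derivatives and to Fubini's theorem.\<close>

sublocale sigma_finite_measure m
proof
  fix c :: 'a
  have "(\<Union>k. cball c (real k)) = UNIV" by (auto simp: real_arch_simple)
  then show "\<exists>A. countable A \<and> A \<subseteq> sets m \<and> \<Union>A = space m \<and> (\<forall>a\<in>A. emeasure m a \<noteq> \<infinity>)"
    using emeasure_bounded_finite[of "cball c _"]
    by (intro exI[of _ "range (\<lambda>k. cball c (real k))"]) (auto simp: less_top)
qed

section \<open>Densities and Renyi entropy of absolutely continuous measures\<close>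

lemma P2_acD:
  assumes "\<mu> \<in> P2_ac m"
  shows "\<mu> \<in> P2" "prob_space \<mu>" "sets \<mu> = sets borel" "absolutely_continuous m \<mu>"
  using assms by (auto simp: P2_ac_def P2_def)

text \<open>Uniform measures are the end points to which the curvature-dimension condition is
  applied.\<close>

lemma uniform_measure_P2_ac:
  assumes A [measurable]: "A \<in> sets borel" and "bounded A" "0 < measure m A"
  shows "uniform_measure m A \<in> P2_ac m"
proof -
  have e: "emeasure m A = ennreal (measure m A)" by (rule emeasure_eq_measure_bounded) fact
  interpret prob_space "uniform_measure m A"
    using assms e by (intro prob_space_uniform_measure) auto
  obtain c R where R: "\<And>x. x \<in> A \<Longrightarrow> dist c x \<le> R" using \<open>bounded A\<close> by (auto simp: bounded_def)
  have "AE x in uniform_measure m A. x \<in> A"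
    by (rule AE_uniform_measureI) auto
  then have "(\<integral>\<^sup>+x. ennreal ((dist c x)\<^sup>2) \<partial>uniform_measure m A) \<le> (\<integral>\<^sup>+x. ennreal (R\<^sup>2) \<partial>uniform_measure m A)"
    by (intro nn_integral_mono_AE) (auto elim!: eventually_mono intro!: ennreal_leI power_mono R)
  also have "\<dots> < \<infinity>" using emeasure_space_1 by simp
  finally have "uniform_measure m A \<in> P2" unfolding P2_def using prob_space_axioms by auto
  moreover have "absolutely_continuous m (uniform_measure m A)"
    unfolding uniform_measure_def by (rule absolutely_continuousI_density) simp
  ultimately show ?thesis by (simp add: P2_ac_def)
qed

text \<open>The density is \<open>1 / measure m A\<close> on \<open>A\<close>.
  \<open>RN_deriv\<close> is determined only up to \<open>m\<close>-null sets, and by absolute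
  continuity these are null for the uniform measure too.\<close>

lemma dens_pow_uniform_measure:
  assumes A [measurable]: "A \<in> sets borel" and "bounded A" "0 < measure m A"
  shows "AE x in uniform_measure m A.
    dens_pow N (RN_deriv m (uniform_measure m A) x) = ennreal (measure m A powr (1 / N))"
proof -
  have e: "emeasure m A = ennreal (measure m A)" by (rule emeasure_eq_measure_bounded) fact
  note P = P2_acD[OF uniform_measure_P2_ac[OF assms]]
  have ae: "AE x in m. indicator A x / emeasure m A = RN_deriv m (uniform_measure m A) x"
    by (rule RN_deriv_unique) (auto simp: uniform_measure_def)
  have "AE x in uniform_measure m A. indicator A x / emeasure m A = RN_deriv m (uniform_measure m A) x"
    by (rule absolutely_continuous_AE[OF _ P(4) ae]) simp
  moreover have "AE x in uniform_measure m A. x \<in> A"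
    by (rule AE_uniform_measureI) auto
  ultimately show ?thesis
  proof eventually_elim
    case (elim x)
    then have "RN_deriv m (uniform_measure m A) x = ennreal (1 / measure m A)"
      using assms(3) divide_ennreal[of 1 "measure m A"] by (simp add: e)
    then show ?case using assms(3)
      by (simp add: dens_pow_def powr_minus powr_divide powr_minus_divide)
  qed
qed

text \<open>\<open>ac_density\<close> is known only through its defining property, which
  \<open>RN_deriv\<close> shows to be satisfiable. As \<open>Z\<close> is \<open>m\<close>-null and
  \<open>\<mu>\<close> is absolutely continuous, the singular term vanishes for whatever function
  was chosen.\<close>

lemma density_ac_density:
  assumes "\<mu> \<in> P2_ac m"
  shows "ac_density m \<mu> \<in> borel_measurable m" "density m (ac_density m \<mu>) = \<mu>"
proof -
  note P = P2_acD[OF assms]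
  let ?Q = "\<lambda>\<rho>. \<rho> \<in> borel_measurable m \<and>
     (\<exists>Z\<in>null_sets m. (\<forall>x\<in>Z. \<rho> x = \<infinity>) \<and>
        (\<forall>A\<in>sets m. emeasure \<mu> A = emeasure (density m \<rho>) A + emeasure \<mu> (A \<inter> Z)))"
  have "?Q (RN_deriv m \<mu>)"
    using density_RN_deriv[OF P(4)] P(3) by (intro conjI bexI[of _ "{}"]) auto
  then have Q: "?Q (ac_density m \<mu>)" unfolding ac_density_def by (rule someI[of ?Q])
  then show meas: "ac_density m \<mu> \<in> borel_measurable m" by blast
  obtain Z where Z: "Z \<in> null_sets m"
    "\<And>A. A \<in> sets m \<Longrightarrow> emeasure \<mu> A = emeasure (density m (ac_density m \<mu>)) A + emeasure \<mu> (A \<inter> Z)"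
    using Q by blast
  show "density m (ac_density m \<mu>) = \<mu>"
  proof (rule measure_eqI)
    fix A assume "A \<in> sets (density m (ac_density m \<mu>))"
    then have A: "A \<in> sets m" by simp
    have "A \<inter> Z \<in> null_sets m" using A Z(1) by (metis null_set_Int1)
    then have "emeasure \<mu> (A \<inter> Z) = 0"
      using P(4) by (auto simp: absolutely_continuous_def null_sets_def)
    then show "emeasure (density m (ac_density m \<mu>)) A = emeasure \<mu> A"
      using Z(2)[OF A] by simp
  qed (simp add: P(3))
qed

text \<open>Jensen's inequality for the concave function x^(1 - 1/N): among densities carried by
  \<open>S\<close> the integral is largest for the uniform one. It is obtained by integrating a
  tangent line over \<open>S\<close>, where both the volume of \<open>S\<close> and the mass 1 are
  known.\<close>

lemma renyi_integral_le:
  assumes \<mu>: "\<mu> \<in> P2_ac m" and S [measurable]: "S \<in> sets borel" and "bounded S"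
    and AE: "AE x in \<mu>. x \<in> S" and N: "1 \<le> N"
  shows "(\<integral>\<^sup>+x. dens_pow N (ac_density m \<mu> x) \<partial>\<mu>) \<le> ennreal (measure m S powr (1 / N))"
proof -
  note P = P2_acD[OF \<mu>]
  interpret u: prob_space \<mu> by (rule P(2))
  define \<rho> where "\<rho> = ac_density m \<mu>"
  have [measurable]: "\<rho> \<in> borel_measurable m" and d: "density m \<rho> = \<mu>"
    using density_ac_density[OF \<mu>] by (auto simp: \<rho>_def)
  have [measurable]: "dens_pow N \<in> borel_measurable borel"
    unfolding dens_pow_def by measurable
  have e: "emeasure m S = ennreal (measure m S)" by (rule emeasure_eq_measure_bounded) fact
  have S1: "emeasure \<mu> S = 1"
    using u.emeasure_eq_1_AE[OF _ AE] P(3) by simp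
  define c where "c = 1 / measure m S"
  have "emeasure m S \<noteq> 0"
  proof
    assume "emeasure m S = 0"
    then have "S \<in> null_sets m" using S by (intro null_setsI) auto
    then have "S \<in> null_sets \<mu>" using P(4) by (auto simp: absolutely_continuous_def)
    then show False using S1 by (simp add: null_sets_def)
  qed
  then have pos: "0 < measure m S" using e by (simp add: zero_less_measure_iff)
  have c: "0 < c" using pos by (simp add: c_def)
  define \<alpha> where "\<alpha> = c powr (1 - 1 / N) / N"
  define \<beta> where "\<beta> = (1 - 1 / N) * c powr (- 1 / N)"
  have \<alpha>\<beta>: "0 \<le> \<alpha>" "0 \<le> \<beta>" using N by (auto simp: \<alpha>_def \<beta>_def)
  \<comment> \<open>the tangent of \<open>x powr (1 - 1 / N)\<close> at the value \<open>c\<close> of a uniform density on \<open>S\<close>\<close>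
  have young: "x * x powr (- 1 / N) \<le> \<alpha> + \<beta> * x" if "0 < x" for x
  proof -
    have "c powr (1 / N) * x powr (1 - 1 / N) \<le> (1 / N) * c + (1 - 1 / N) * x"
      using N that c by (intro Youngs_inequality_0) auto
    then have "c powr (- 1 / N) * (c powr (1 / N) * x powr (1 - 1 / N))
        \<le> c powr (- 1 / N) * ((1 / N) * c + (1 - 1 / N) * x)"
      by (intro mult_left_mono) auto
    also have "\<dots> = \<alpha> + \<beta> * x"
    proof -
      have "c powr (1 - 1 / N) = c powr (- 1 / N) * c"
        using c powr_add[of c "- 1 / N" 1] by (simp add: add.commute)
      then show ?thesis unfolding \<alpha>_def \<beta>_def by (simp add: algebra_simps)
    qed
    also have "c powr (- 1 / N) * (c powr (1 / N) * x powr (1 - 1 / N)) = x powr (1 - 1 / N)"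
      using c by (simp add: mult.assoc[symmetric] powr_add[symmetric])
    also have "\<dots> = x * x powr (- 1 / N)"
      using that powr_add[of x "- 1 / N" 1] by (simp add: add.commute mult.commute)
    finally show ?thesis .
  qed
  \<comment> \<open>At r = \<infinity> the left-hand side is 0, because \<open>enn2real\<close>
    gives 0 there and \<open>0 powr a = 0\<close>. This covers N = 1, where \<beta> = 0.\<close>
  have pt: "r * dens_pow N r \<le> ennreal \<alpha> + ennreal \<beta> * r" for r :: ennreal
  proof (cases r)
    case (real x)
    then show ?thesis
      using young[of x] \<alpha>\<beta>
      by (cases "x = 0") (auto simp: dens_pow_def ennreal_mult[symmetric] ennreal_plus[symmetric]
          intro!: ennreal_leI simp del: ennreal_plus)
  qed (simp add: dens_pow_def)
  have "(\<integral>\<^sup>+x. dens_pow N (\<rho> x) \<partial>\<mu>) = (\<integral>\<^sup>+x. dens_pow N (\<rho> x) * indicator S x \<partial>\<mu>)"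
    using AE by (intro nn_integral_cong_AE) (auto elim!: eventually_mono)
  also have "\<dots> = (\<integral>\<^sup>+x. \<rho> x * (dens_pow N (\<rho> x) * indicator S x) \<partial>m)"
    by (subst d[symmetric], subst nn_integral_density) auto
  also have "\<dots> \<le> (\<integral>\<^sup>+x. ennreal \<alpha> * indicator S x + ennreal \<beta> * (\<rho> x * indicator S x) \<partial>m)"
    using pt by (intro nn_integral_mono) (auto simp: indicator_def)
  also have "\<dots> = ennreal \<alpha> * emeasure m S + ennreal \<beta> * (\<integral>\<^sup>+x. \<rho> x * indicator S x \<partial>m)"
    by (subst nn_integral_add) (auto simp: nn_integral_cmult)
  also have "(\<integral>\<^sup>+x. \<rho> x * indicator S x \<partial>m) = 1"
    using S1 by (subst (asm) d[symmetric]) (simp add: emeasure_density)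
  also have "ennreal \<alpha> * emeasure m S + ennreal \<beta> * 1 = ennreal (\<alpha> * measure m S + \<beta>)"
    using \<alpha>\<beta> by (simp add: e ennreal_mult)
  also have "\<alpha> * measure m S + \<beta> = measure m S powr (1 / N)"
  proof -
    have "c powr (1 - 1 / N) = c * c powr (- 1 / N)"
      using c powr_add[of c "- 1 / N" 1] by (simp add: add.commute mult.commute)
    then have "\<alpha> * measure m S = c powr (- 1 / N) / N" using pos by (simp add: \<alpha>_def c_def)
    then have "\<alpha> * measure m S + \<beta> = c powr (- 1 / N)" by (simp add: \<beta>_def algebra_simps)
    then show ?thesis using pos by (simp add: c_def powr_divide powr_minus_divide)
  qed
  finally show ?thesis by (simp add: \<rho>_def)
qed


section \<open>From the curvature-dimension condition to volumes of balls\<close>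

text \<open>For uniform end points the densities become volumes of \<open>A\<close> and
  \<open>B\<close>. The intermediate measure lives in the interpolated ball by
  \<open>geodesic_localized\<close>, so \<open>renyi_integral_le\<close> applies to it. The
  distortion coefficients stay under the integral to serve both K > 0 and K = 0.\<close>

lemma CD_cball_estimate:
  assumes CD: "CD K N m" and N: "1 \<le> N" and t: "0 < t" "t < 1" and Rr: "0 \<le> R" "0 \<le> r"
    and A [measurable]: "A \<in> sets borel" and A': "A \<subseteq> cball c R" "0 < measure m A"
    and B [measurable]: "B \<in> sets borel" and B': "B \<subseteq> cball c r" "0 < measure m B"
  obtains \<pi> where "\<pi> \<in> couplings (uniform_measure m A) (uniform_measure m B)"
    "(\<integral>\<^sup>+z. distortion K N (1 - t) (dist (fst z) (snd z)) * ennreal (measure m A powr (1 / N))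
        + distortion K N t (dist (fst z) (snd z)) * ennreal (measure m B powr (1 / N)) \<partial>\<pi>)
      \<le> ennreal (measure m (cball c ((1 - t) * (R + r) + r)) powr (1 / N))"
proof -
  have bdd: "bounded A" "bounded B" using A' B' bounded_cball bounded_subset by blast+
  let ?a = "uniform_measure m A" and ?b = "uniform_measure m B"
  let ?d = "\<lambda>z. dist (fst z) (snd z)"
  have P: "?a \<in> P2_ac m" "?b \<in> P2_ac m"
    using uniform_measure_P2_ac A B bdd A'(2) B'(2) by auto
  obtain \<pi> \<Gamma> where opt: "optimal_coupling ?a ?b \<pi>" and geo: "W2_geodesic (P2_ac m) ?a ?b \<Gamma>"
    and ent: "\<forall>t\<in>{0..1}. \<forall>N'\<ge>N. renyi_entropy N' m (\<Gamma> t) \<le>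
           - enn2ereal (\<integral>\<^sup>+z. distortion K N' (1 - t) (?d z) * dens_pow N' (RN_deriv m ?a (fst z))
               + distortion K N' t (?d z) * dens_pow N' (RN_deriv m ?b (snd z)) \<partial>\<pi>)"
    using CD P unfolding CD_def by blast
  have \<pi>: "\<pi> \<in> couplings ?a ?b" using opt by (simp add: optimal_coupling_def)
  have "\<Gamma> t \<in> P2_ac m" using geo t by (auto simp: W2_geodesic_def)
  moreover have "AE z in \<Gamma> t. z \<in> cball c ((1 - t) * (R + r) + r)"
  proof -
    have "\<forall>x. x \<in> A \<longrightarrow> dist c x \<le> R" "\<forall>x. x \<in> B \<longrightarrow> dist c x \<le> r"
      using A'(1) B'(1) by auto
    then have "AE x in ?a. dist c x \<le> R" "AE x in ?b. dist c x \<le> r"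
      by (simp_all add: AE_uniform_measureI)
    from geodesic_localized[OF geo _ t Rr this] show ?thesis by (auto simp: P2_ac_def)
  qed
  ultimately have "(\<integral>\<^sup>+x. dens_pow N (ac_density m (\<Gamma> t) x) \<partial>\<Gamma> t)
      \<le> ennreal (measure m (cball c ((1 - t) * (R + r) + r)) powr (1 / N))"
    using N by (intro renyi_integral_le) auto
  \<comment> \<open>Both sides of the entropy inequality carry a minus sign; removing it reverses
    the inequality.\<close>
  moreover have "(\<integral>\<^sup>+z. distortion K N (1 - t) (?d z) * dens_pow N (RN_deriv m ?a (fst z))
       + distortion K N t (?d z) * dens_pow N (RN_deriv m ?b (snd z)) \<partial>\<pi>)
     \<le> (\<integral>\<^sup>+x. dens_pow N (ac_density m (\<Gamma> t) x) \<partial>\<Gamma> t)"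
    using ent[rule_format, of t N] t by (simp add: renyi_entropy_def less_eq_ennreal.rep_eq)
  moreover have "(\<integral>\<^sup>+z. distortion K N (1 - t) (?d z) * dens_pow N (RN_deriv m ?a (fst z))
       + distortion K N t (?d z) * dens_pow N (RN_deriv m ?b (snd z)) \<partial>\<pi>)
     = (\<integral>\<^sup>+z. distortion K N (1 - t) (?d z) * ennreal (measure m A powr (1 / N))
        + distortion K N t (?d z) * ennreal (measure m B powr (1 / N)) \<partial>\<pi>)"
    using coupling_AE(1)[OF \<pi> dens_pow_uniform_measure[OF A bdd(1) A'(2), of N]]
      coupling_AE(2)[OF \<pi> dens_pow_uniform_measure[OF B bdd(2) B'(2), of N]]
    by (intro nn_integral_cong_AE, eventually_elim) simp
  ultimately show ?thesis using that[OF \<pi>] by simp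
qed

text \<open>A qualitative Bonnet-Myers theorem. If two points are too far apart, every pair of
  points from their unit balls has infinite distortion, and transport between these balls
  contradicts the finite volume bound.\<close>

lemma CD_positive_bounded:
  assumes "CD K N m" "1 < N" "0 < K"
  shows "bounded (UNIV :: 'a set)"
proof (rule ccontr)
  assume unb: "\<not> bounded (UNIV :: 'a set)"
  define L where "L = pi * sqrt ((N - 1) / K)"
  fix x :: 'a
  \<comment> \<open>The 2 pays for the radii of the two unit balls.\<close>
  obtain y where y: "dist x y > L + 2"
    using unb unfolding bounded_def by (metis UNIV_I not_le)
  have L0: "0 \<le> L" using assms by (simp add: L_def)
  have far: "distortion K N (1/2) (dist u v) = \<infinity>" if "u \<in> ball x 1" "v \<in> ball y 1" for u v
  proof -
    have "dist x y \<le> dist x u + dist u v + dist v y"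
      using dist_triangle[of x y u] dist_triangle[of u y v] by linarith
    then have "L < dist u v" using that y by (simp add: dist_commute)
    then have "L\<^sup>2 \<le> (dist u v)\<^sup>2" using L0 by (intro power_mono) auto
    then have "(N - 1) / K * pi\<^sup>2 \<le> (dist u v)\<^sup>2"
      using assms by (simp add: L_def power_mult_distrib mult.commute)
    then have "(N - 1) * pi\<^sup>2 \<le> K * (dist u v)\<^sup>2"
      using assms by (simp add: field_simps)
    \<comment> \<open>Excludes \<open>K * s\<^sup>2 = 0\<close>, the case that
      \<open>distortion\<close> tests first.\<close>
    moreover have "0 < (N - 1) * pi\<^sup>2" using assms by simp
    ultimately show ?thesis unfolding distortion_def using order_less_le_trans by fastforce
  qed
  let ?a = "uniform_measure m (ball x 1)" and ?b = "uniform_measure m (ball y 1)"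
  \<comment> \<open>\<open>CD_cball_estimate\<close> asks for balls with a common centre, here
    \<open>y\<close>.\<close>
  have "ball x 1 \<subseteq> cball y (dist x y + 1)"
  proof
    fix z assume "z \<in> ball x 1"
    then show "z \<in> cball y (dist x y + 1)" using dist_triangle[of y z x] by (simp add: dist_commute)
  qed
  then obtain \<pi> where \<pi>: "\<pi> \<in> couplings ?a ?b"
    and le: "(\<integral>\<^sup>+z. distortion K N (1 - 1/2) (dist (fst z) (snd z)) * ennreal (measure m (ball x 1) powr (1 / N))
        + distortion K N (1/2) (dist (fst z) (snd z)) * ennreal (measure m (ball y 1) powr (1 / N)) \<partial>\<pi>)
      \<le> ennreal (measure m (cball y ((1 - 1/2) * ((dist x y + 1) + 1) + 1)) powr (1 / N))"
    using CD_cball_estimate[OF assms(1), of "1/2" "dist x y + 1" 1 "ball x 1" y "ball y 1"] assms(2)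
      measure_ball_pos by (auto simp: ball_subset_cball)
  interpret \<pi>: prob_space \<pi> by (rule couplingD(1)[OF \<pi>])
  have "AE z in ?a. z \<in> ball x 1" "AE z in ?b. z \<in> ball y 1"
    by (rule AE_uniform_measureI; simp)+
  from coupling_AE(1)[OF \<pi> this(1)] coupling_AE(2)[OF \<pi> this(2)]
  have "AE z in \<pi>. distortion K N (1 - 1/2) (dist (fst z) (snd z)) * ennreal (measure m (ball x 1) powr (1 / N))
        + distortion K N (1/2) (dist (fst z) (snd z)) * ennreal (measure m (ball y 1) powr (1 / N)) = \<infinity>"
  proof eventually_elim
    case (elim z)
    have "measure m (ball y 1) \<noteq> 0" using measure_ball_pos[of 1 y] by simp
    then show ?case using far[OF elim] by (simp add: ennreal_top_mult)
  qed
  then have "(\<integral>\<^sup>+z. distortion K N (1 - 1/2) (dist (fst z) (snd z)) * ennreal (measure m (ball x 1) powr (1 / N))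
        + distortion K N (1/2) (dist (fst z) (snd z)) * ennreal (measure m (ball y 1) powr (1 / N)) \<partial>\<pi>)
      = (\<integral>\<^sup>+z. \<infinity> \<partial>\<pi>)" by (rule nn_integral_cong_AE)
  also have "\<dots> = \<infinity>" by (simp add: \<pi>.emeasure_space_1)
  finally show False using le by (simp add: top_unique)
qed

text \<open>Continuity from above: a closed ball is the intersection of slightly larger closed
  balls, all of finite measure.\<close>

lemma measure_cball_tendsto:
  "(\<lambda>j. measure m (cball c (\<rho> + a / real (Suc j)))) \<longlonglongrightarrow> measure m (cball c \<rho>)" if "0 \<le> a"
proof -
  have "(\<lambda>j. measure m (cball c (\<rho> + a / real (Suc j)))) \<longlonglongrightarrow> measure m (\<Inter>j. cball c (\<rho> + a / real (Suc j)))"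
  proof (rule Lim_measure_decseq)
    show "decseq (\<lambda>j. cball c (\<rho> + a / real (Suc j)))"
      using that by (intro decseq_SucI subset_cball add_left_mono divide_left_mono) auto
  qed (use emeasure_bounded_finite[OF bounded_cball] in \<open>auto simp: less_top\<close>)
  also have "(\<Inter>j. cball c (\<rho> + a / real (Suc j))) = cball c \<rho>"
  proof (intro equalityI subsetI)
    fix z assume z: "z \<in> (\<Inter>j. cball c (\<rho> + a / real (Suc j)))"
    have "(\<lambda>j. \<rho> + a * (1 / real (Suc j))) \<longlonglongrightarrow> \<rho> + a * 0"
      by (intro tendsto_intros LIMSEQ_Suc[OF lim_1_over_n])
    then have "dist c z \<le> \<rho> + a * 0" by (rule LIMSEQ_le_const) (use z in auto)
    then show "z \<in> cball c \<rho>" by simp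
  next
    fix z assume z: "z \<in> cball c \<rho>"
    have "\<rho> \<le> \<rho> + a / real (Suc j)" for j using that by simp
    then show "z \<in> (\<Inter>j. cball c (\<rho> + a / real (Suc j)))" using z by (auto intro: order_trans)
  qed
  finally show ?thesis .
qed

text \<open>Transport to a ball of radius \<open>r\<close> with the same centre, in the limit of vanishing \<open>r\<close>.\<close>
lemma CD0_cball_scaling:
  assumes CD: "CD 0 N m" and N: "1 \<le> N" and s: "0 < s" "s < 1" and R: "0 < R"
  shows "s powr N * measure m (cball c R) \<le> measure m (cball c (s * R))"
proof -
  define t where "t = 1 - s"
  have t: "0 < t" "t < 1" "1 - t = s" using s by (auto simp: t_def)
  have "s * measure m (cball c R) powr (1 / N) \<le> measure m (cball c (s * R + (s + 1) / real (Suc j))) powr (1 / N)" for j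
  proof -
    define r where "r = 1 / real (Suc j)"
    have r: "0 < r" by (simp add: r_def)
    obtain \<pi> where \<pi>: "\<pi> \<in> couplings (uniform_measure m (cball c R)) (uniform_measure m (cball c r))"
      and le: "(\<integral>\<^sup>+z. distortion 0 N (1 - t) (dist (fst z) (snd z)) * ennreal (measure m (cball c R) powr (1 / N))
        + distortion 0 N t (dist (fst z) (snd z)) * ennreal (measure m (cball c r) powr (1 / N)) \<partial>\<pi>)
      \<le> ennreal (measure m (cball c ((1 - t) * (R + r) + r)) powr (1 / N))"
      using CD_cball_estimate[OF CD N t(1,2), of R r "cball c R" c "cball c r"] R r
        measure_cball_pos by auto
    interpret \<pi>: prob_space \<pi> by (rule couplingD(1)[OF \<pi>])
    have "ennreal (s * measure m (cball c R) powr (1 / N)) = (\<integral>\<^sup>+z. ennreal (s * measure m (cball c R) powr (1 / N)) \<partial>\<pi>)"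
      by (simp add: \<pi>.emeasure_space_1)
    \<comment> \<open>For K = 0 the coefficients are the constants s and t; the term of the small
      target ball is dropped.\<close>
    also have "\<dots> \<le> (\<integral>\<^sup>+z. distortion 0 N (1 - t) (dist (fst z) (snd z)) * ennreal (measure m (cball c R) powr (1 / N))
        + distortion 0 N t (dist (fst z) (snd z)) * ennreal (measure m (cball c r) powr (1 / N)) \<partial>\<pi>)"
      using s by (intro nn_integral_mono) (simp add: distortion_def t(3) ennreal_mult)
    also note le
    finally have "s * measure m (cball c R) powr (1 / N) \<le> measure m (cball c ((1 - t) * (R + r) + r)) powr (1 / N)"
      by simp
    also have "(1 - t) * (R + r) + r = s * R + (s + 1) / real (Suc j)"
      by (simp add: t(3) r_def field_simps)
    finally show ?thesis .
  qed
  moreover have "(\<lambda>j. measure m (cball c (s * R + (s + 1) / real (Suc j))) powr (1 / N))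
      \<longlonglongrightarrow> measure m (cball c (s * R)) powr (1 / N)"
    using s R measure_cball_pos[of "s * R" c]
    by (intro tendsto_powr measure_cball_tendsto tendsto_const) auto
  ultimately have "s * measure m (cball c R) powr (1 / N) \<le> measure m (cball c (s * R)) powr (1 / N)"
    by (intro LIMSEQ_le_const) auto
  then have "(s * measure m (cball c R) powr (1 / N)) powr N \<le> (measure m (cball c (s * R)) powr (1 / N)) powr N"
    using N s by (intro powr_mono2) auto
  then show ?thesis using N s by (simp add: powr_mult powr_powr)
qed

text \<open>Spheres are null: for s < 1 the open ball contains the closed ball of radius s R, which
  has at least the fraction s^N of the measure of the full closed ball. Let s tend to 1.\<close>

lemma CD0_measure_cball_eq_ball:
  assumes CD: "CD 0 N m" and N: "1 \<le> N" and R: "0 < R"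
  shows "measure m (cball c R) = measure m (ball c R)"
proof (rule antisym)
  \<comment> \<open>The double successor keeps s = 1 - 1/(j + 2) positive at j = 0.\<close>
  have "(\<lambda>j. (1 - 1 / real (Suc (Suc j))) powr N * measure m (cball c R)) \<longlonglongrightarrow> (1 - 0) powr N * measure m (cball c R)"
    by (intro tendsto_intros LIMSEQ_Suc[OF LIMSEQ_Suc[OF lim_1_over_n]]) auto
  moreover have "(1 - 1 / real (Suc (Suc j))) powr N * measure m (cball c R) \<le> measure m (ball c R)" for j
  proof -
    let ?s = "1 - 1 / real (Suc (Suc j))"
    have s: "0 < ?s" "?s < 1" by auto
    have "?s powr N * measure m (cball c R) \<le> measure m (cball c (?s * R))"
      by (rule CD0_cball_scaling[OF CD N s R])
    also have "\<dots> \<le> measure m (ball c R)"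
    proof (rule measure_mono_bounded)
      have "?s * R < R" using R s by simp
      then show "cball c (?s * R) \<subseteq> ball c R" by auto
    qed auto
    finally show ?thesis .
  qed
  ultimately show "measure m (cball c R) \<le> measure m (ball c R)"
    by (intro LIMSEQ_le_const2) auto
  show "measure m (ball c R) \<le> measure m (cball c R)"
    by (rule measure_mono_bounded) auto
qed

text \<open>This is \<open>CD0_cball_scaling\<close> with s = r / R, transferred to open balls; r =
  R is separate because scaling asks for s < 1.\<close>

lemma CD0_Bishop_Gromov:
  assumes CD: "CD 0 N m" and N: "1 \<le> N" and r: "0 < r" "r \<le> R"
  shows "(r / R) powr N * measure m (ball c R) \<le> measure m (ball c r)"
proof (cases "r = R")
  case False
  then have "(r / R) powr N * measure m (cball c R) \<le> measure m (cball c (r / R * R))"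
    using r by (intro CD0_cball_scaling[OF CD N]) auto
  then show ?thesis using r CD0_measure_cball_eq_ball[OF CD N] by simp
qed (use r in simp)

end

section \<open>The Faber-Krahn-type inequality\<close>

lemma powr_diff_le:
  fixes a b q :: real
  assumes "0 \<le> a" "a \<le> b" "1 \<le> q"
  shows "b powr q - a powr q \<le> q * b powr (q - 1) * (b - a)"
proof (cases "a = 0 \<or> a = b")
  \<comment> \<open>The mean value theorem is used for 0 < a < b, where the power is differentiable
    on the closed interval; the remaining cases are direct.\<close>
  case True
  have "b powr q = b powr (q - 1) * b" if "b \<noteq> 0"
    using that assms powr_add[of b "q - 1" 1] by simp
  then have "b powr q \<le> q * (b powr (q - 1) * b)"
    using assms mult_right_mono[of 1 q "b powr q"] by (cases "b = 0") auto
  then show ?thesis using True by (auto simp: mult.assoc)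
next
  case False
  then have ab: "0 < a" "a < b" using assms by auto
  have "\<exists>z>a. z < b \<and> b powr q - a powr q = (b - a) * (q * z powr (q - 1))"
    using ab by (intro MVT2) (auto intro!: derivative_eq_intros)
  then obtain z where z: "a < z" "z < b" "b powr q - a powr q = (b - a) * (q * z powr (q - 1))"
    by blast
  have "(b - a) * (q * z powr (q - 1)) \<le> (b - a) * (q * b powr (q - 1))"
    using z ab assms by (intro mult_left_mono powr_mono2) auto
  then show ?thesis using z(3) by (simp add: mult_ac)
qed

lemma powr_abs_diff_le:
  fixes a b q :: real
  assumes "0 \<le> a" "0 \<le> b" "1 \<le> q"
  shows "\<bar>a powr q - b powr q\<bar> \<le> q * max a b powr (q - 1) * \<bar>a - b\<bar>"
proof (cases "a \<le> b")
  case True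
  then have "a powr q \<le> b powr q" using assms by (intro powr_mono2) simp_all
  then show ?thesis using powr_diff_le[of a b q] True assms by simp
next
  case False
  then have "b powr q \<le> a powr q" using assms by (intro powr_mono2) simp_all
  then show ?thesis using powr_diff_le[of b a q] False assms by simp
qed

text \<open>For \<open>q = p / (p - 1)\<close> these are the extremals of the Euclidean Faber-Krahn-type inequality.\<close>
definition bump :: "real \<Rightarrow> real \<Rightarrow> 'a::metric_space \<Rightarrow> 'a \<Rightarrow> real" where
  "bump q l c x = l powr q - min (dist c x) l powr q"

lemma bump_eq: "bump q l c x = indicator (cball c l) x * (l powr q - dist c x powr q)"
  by (cases "dist c x \<le> l") (simp_all add: bump_def)

text \<open>The truncated distance \<open>min (dist c x) l\<close> is 1-Lipschitz in
  \<open>x\<close>. The estimate serves both the global Lipschitz bound, where the maximum is at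
  most l, and the local slope, where y is close to x.\<close>

lemma bump_diff_le:
  assumes "1 \<le> q" "0 \<le> l"
  shows "\<bar>bump q l c y - bump q l c x\<bar> \<le>
    q * max (min (dist c x) l) (min (dist c y) l) powr (q - 1) * dist x y"
proof -
  define a b where "a = min (dist c x) l" and "b = min (dist c y) l"
  have ab: "0 \<le> a" "0 \<le> b" using assms by (simp_all add: a_def b_def)
  have "dist c x \<le> dist c y + dist x y" "dist c y \<le> dist c x + dist x y"
    using dist_triangle2[of c x y] dist_triangle[of c y x] by simp_all
  then have d: "\<bar>a - b\<bar> \<le> dist x y" unfolding a_def b_def by linarith
  have "\<bar>bump q l c y - bump q l c x\<bar> = \<bar>a powr q - b powr q\<bar>"
    by (simp add: bump_def a_def b_def)
  also have "\<dots> \<le> q * max a b powr (q - 1) * \<bar>a - b\<bar>"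
    by (rule powr_abs_diff_le) fact+
  also have "\<dots> \<le> q * max a b powr (q - 1) * dist x y"
    using d assms by (intro mult_left_mono) simp_all
  finally show ?thesis by (simp add: a_def b_def)
qed

lemma lipschitz_bump:
  assumes "1 \<le> q" "0 \<le> l"
  shows "(q * l powr (q - 1))-lipschitz_on UNIV (bump q l c)"
proof (rule lipschitz_onI)
  fix x y :: 'a
  have "\<bar>bump q l c x - bump q l c y\<bar> \<le> q * max (min (dist c y) l) (min (dist c x) l) powr (q - 1) * dist y x"
    by (rule bump_diff_le[OF assms])
  also have "\<dots> \<le> q * l powr (q - 1) * dist y x"
    using assms by (intro mult_right_mono mult_left_mono powr_mono2) (auto simp: le_max_iff_disj)
  finally show "dist (bump q l c x) (bump q l c y) \<le> q * l powr (q - 1) * dist x y"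
    by (simp add: dist_real_def dist_commute)
qed (use assms in simp)

lemma fun_support_bump: "fun_support (bump q l c) \<subseteq> cball c l"
  unfolding fun_support_def
proof (rule closure_minimal)
  have "bump q l c x = 0" if "x \<notin> cball c l" for x using that by (simp add: bump_eq)
  then show "{x. bump q l c x \<noteq> 0} \<subseteq> cball c l" by blast
qed (rule closed_cball)

lemma local_slope_nonneg: "0 \<le> local_slope u x"
  by (simp add: local_slope_def)

text \<open>The slack \<open>e\<close> admits difference bounds whose constants merely converge to
  \<open>B\<close> as y tends to x.\<close>

lemma local_slope_le:
  assumes "0 \<le> B" "\<And>e. 0 < e \<Longrightarrow> \<forall>\<^sub>F y in at x. \<bar>u y - u x\<bar> \<le> (B + e) * dist x y"
  shows "local_slope u x \<le> B"
proof -
  have *: "Limsup (at x) (\<lambda>y. ennreal (\<bar>u y - u x\<bar> / dist x y)) \<le> ennreal B + ennreal e" if "0 < e" for e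
  proof (rule Limsup_bounded)
    have "\<forall>\<^sub>F y in at x. y \<noteq> x" by (rule eventually_neq_at_within)
    with assms(2)[OF that]
    show "\<forall>\<^sub>F y in at x. ennreal (\<bar>u y - u x\<bar> / dist x y) \<le> ennreal B + ennreal e"
    proof eventually_elim
      case (elim y)
      then have "\<bar>u y - u x\<bar> / dist x y \<le> B + e" by (simp add: divide_le_eq)
      then show ?case using assms(1) that by (simp add: ennreal_plus[symmetric] ennreal_leI del: ennreal_plus)
    qed
  qed
  have "Limsup (at x) (\<lambda>y. ennreal (\<bar>u y - u x\<bar> / dist x y)) \<le> ennreal B"
    by (rule ennreal_le_epsilon) (rule *)
  then show ?thesis unfolding local_slope_def by (rule enn2real_leI[OF assms(1)])
qed

text \<open>In the closed ball, boundary included, the constant of \<open>bump_diff_le\<close> is at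
  most q (dist c x + dist x y)^(q - 1), which tends to the claimed bound. Outside, the function
  vanishes near \<open>x\<close>.\<close>

lemma local_slope_bump_le:
  assumes q: "1 < q" and l: "0 \<le> l"
  shows "local_slope (bump q l c) x \<le> indicator (cball c l) x * (q * dist c x powr (q - 1))"
proof (cases "x \<in> cball c l")
  case True
  have "local_slope (bump q l c) x \<le> q * dist c x powr (q - 1)"
  proof (rule local_slope_le)
    fix e :: real assume e: "0 < e"
    have "((\<lambda>y. dist c x + dist x y) \<longlongrightarrow> dist c x + dist x x) (at x)"
      by (intro tendsto_intros)
    then have "((\<lambda>y. (dist c x + dist x y) powr (q - 1)) \<longlongrightarrow> (dist c x + dist x x) powr (q - 1)) (at x)"
      by (rule tendsto_powr'[OF _ tendsto_const]) (use q in simp)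
    then have "((\<lambda>y. q * (dist c x + dist x y) powr (q - 1)) \<longlongrightarrow> q * (dist c x + dist x x) powr (q - 1)) (at x)"
      by (rule tendsto_mult_left)
    then have "\<forall>\<^sub>F y in at x. q * (dist c x + dist x y) powr (q - 1) < q * dist c x powr (q - 1) + e"
      using e by (intro order_tendstoD) auto
    then show "\<forall>\<^sub>F y in at x. \<bar>bump q l c y - bump q l c x\<bar> \<le> (q * dist c x powr (q - 1) + e) * dist x y"
    proof eventually_elim
      case (elim y)
      have "max (min (dist c x) l) (min (dist c y) l) \<le> dist c x + dist x y"
        using dist_triangle[of c y x] by (intro max.boundedI) (auto simp: min_le_iff_disj)
      then have "q * max (min (dist c x) l) (min (dist c y) l) powr (q - 1) \<le> q * (dist c x + dist x y) powr (q - 1)"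
        using q l by (intro mult_left_mono powr_mono2) (auto simp: le_max_iff_disj)
      also have "\<dots> \<le> q * dist c x powr (q - 1) + e" using elim by simp
      finally have "q * max (min (dist c x) l) (min (dist c y) l) powr (q - 1) * dist x y
         \<le> (q * dist c x powr (q - 1) + e) * dist x y" by (rule mult_right_mono) simp
      then show ?case using bump_diff_le[of q l c y x] q l by simp
    qed
  qed (use q in simp)
  then show ?thesis using True by simp
next
  case False
  have "\<forall>\<^sub>F y in at x. y \<in> - cball c l"
    using False by (intro topological_tendstoD[OF tendsto_ident_at]) auto
  then have "\<forall>\<^sub>F y in at x. \<bar>bump q l c y - bump q l c x\<bar> \<le> (0 + e) * dist x y" if "0 < e" for e
    by (rule eventually_mono) (use that False in \<open>simp add: bump_eq\<close>)
  then have "local_slope (bump q l c) x \<le> 0" by (intro local_slope_le) auto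
  then show ?thesis using False by simp
qed

section \<open>Integrals of the test functions and the volume bound\<close>

context proper_mms
begin

lemma integrable_bounded_support:
  fixes f :: "'a \<Rightarrow> real"
  assumes [measurable]: "f \<in> borel_measurable borel" and "\<And>x. \<bar>f x\<bar> \<le> B" and "\<And>x. x \<notin> cball c R \<Longrightarrow> f x = 0"
  shows "integrable m f"
proof (rule Bochner_Integration.integrable_bound)
  show "integrable m (\<lambda>x. B * indicator (cball c R) x)"
    by (intro integrable_mult_right integrable_real_indicator emeasure_bounded_finite) simp_all
  have "norm (f x) \<le> norm (B * indicator (cball c R) x)" for x
  proof (cases "x \<in> cball c R")
    case True
    then show ?thesis using assms(2)[of x] by simp
  next
    case False
    then show ?thesis using assms(3)[of x] by simp
  qed
  then show "AE x in m. norm (f x) \<le> norm (B * indicator (cball c R) x)" by simp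
qed measurable

lemma borel_measurable_bump [measurable]: "bump q l c \<in> borel_measurable (borel :: 'a measure)"
  unfolding bump_def by measurable

lemma integrable_bump: "0 \<le> q \<Longrightarrow> 0 \<le> l \<Longrightarrow> integrable m (bump q l c)"
  by (rule integrable_bounded_support[of _ "l powr q" c l])
    (auto simp: bump_eq indicator_def powr_mono2)

text \<open>Layer-cake formula: the integral is that of the measure of
  \<open>{x. min (dist c x) l powr q < s}\<close> over s from 0 to l^q. This set contains the ball
  of radius s^(1/q), whose measure is at least V s^(N/q) / l^N by Bishop-Gromov. Integration in s
  gives the bound, an equality for Euclidean cones.\<close>

lemma CD0_integral_bump_ge:
  assumes CD: "CD 0 N m" and N: "1 \<le> N" and q: "0 < q" and l: "0 < l"
  shows "measure m (ball c l) * l powr q * (q / (N + q)) \<le> (\<integral>x. bump q l c x \<partial>m)"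
proof -
  define V where "V = measure m (ball c l)"
  define I where "I = {0..l powr q}"
  have bump0: "0 \<le> bump q l c x" for x using q l by (auto simp: bump_def intro!: powr_mono2)
  have layer: "ennreal (bump q l c x) = (\<integral>\<^sup>+s. indicator {s. min (dist c x) l powr q < s \<and> s \<in> I} s \<partial>lborel)" for x
  proof -
    have "{s. min (dist c x) l powr q < s \<and> s \<in> I} = {min (dist c x) l powr q<..l powr q}"
      by (auto simp: I_def intro: order_trans[OF powr_ge_zero less_imp_le])
    moreover have "min (dist c x) l powr q \<le> l powr q" using q l by (intro powr_mono2) auto
    ultimately show ?thesis by (simp add: bump_def)
  qed
  have set: "{x. min (dist c x) l powr q < s} \<supseteq> ball c (s powr (1 / q))" if "s \<in> I" for s
  proof
    fix x assume "x \<in> ball c (s powr (1 / q))"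
    then have "dist c x < s powr (1 / q)" by simp
    then have "dist c x powr q < (s powr (1 / q)) powr q" using q by (intro powr_less_mono2) auto
    then have "dist c x powr q < s" using that q by (simp add: powr_powr I_def)
    moreover have "min (dist c x) l powr q \<le> dist c x powr q" using q l by (intro powr_mono2) auto
    ultimately show "x \<in> {x. min (dist c x) l powr q < s}" by simp
  qed
  have "(\<integral>\<^sup>+s. ennreal (V / l powr N) * (indicator I s * ennreal (s powr (N / q))) \<partial>lborel)
     \<le> (\<integral>\<^sup>+s. \<integral>\<^sup>+x. indicator {s. min (dist c x) l powr q < s \<and> s \<in> I} s \<partial>m \<partial>lborel)"
  proof (rule nn_integral_mono)
    fix s :: real
    show "ennreal (V / l powr N) * (indicator I s * ennreal (s powr (N / q)))
       \<le> (\<integral>\<^sup>+x. indicator {s. min (dist c x) l powr q < s \<and> s \<in> I} s \<partial>m)"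
    \<comment> \<open>Outside \<open>I\<close> the indicator vanishes, and at s = 0 the convention
      \<open>0 powr a = 0\<close> makes the left-hand side 0.\<close>
    proof (cases "s \<in> I \<and> s \<noteq> 0")
      case True
      then have s: "s \<in> I" "0 < s" "s \<le> l powr q" by (auto simp: I_def)
      define r where "r = s powr (1 / q)"
      have "r \<le> (l powr q) powr (1 / q)" unfolding r_def using s q by (intro powr_mono2) auto
      then have r: "0 < r" "r \<le> l" using s q l by (auto simp: r_def powr_powr)
      have "V / l powr N * s powr (N / q) = (r / l) powr N * V"
        using s l q by (simp add: r_def powr_divide powr_powr)
      also have "\<dots> \<le> measure m (ball c r)"
        unfolding V_def by (rule CD0_Bishop_Gromov[OF CD N r])
      finally have "ennreal (V / l powr N * s powr (N / q)) \<le> emeasure m (ball c r)"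
        by (simp add: emeasure_eq_measure_bounded ennreal_leI)
      also have "\<dots> = (\<integral>\<^sup>+x. indicator (ball c r) x \<partial>m)" by simp
      also have "\<dots> \<le> (\<integral>\<^sup>+x. indicator {s. min (dist c x) l powr q < s \<and> s \<in> I} s \<partial>m)"
        using set[OF s(1)] s(1) by (intro nn_integral_mono) (auto simp: r_def indicator_def split: if_splits)
      finally have le: "ennreal (V / l powr N * s powr (N / q))
          \<le> (\<integral>\<^sup>+x. indicator {s. min (dist c x) l powr q < s \<and> s \<in> I} s \<partial>m)" .
      have "ennreal (V / l powr N * s powr (N / q)) = ennreal (V / l powr N) * ennreal (s powr (N / q))"
        by (rule ennreal_mult) (auto simp: V_def)
      with le show ?thesis by (simp only: indicator_simps(1)[OF s(1)] mult_1)
    qed auto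
  qed
  also have "\<dots> = (\<integral>\<^sup>+x. \<integral>\<^sup>+s. indicator {s. min (dist c x) l powr q < s \<and> s \<in> I} s \<partial>lborel \<partial>m)"
  proof -
    interpret pair_sigma_finite m lborel ..
    show ?thesis
      by (rule Fubini'[of "\<lambda>x s. indicator {s. min (dist c x) l powr q < s \<and> s \<in> I} s"])
        (unfold I_def, measurable)
  qed
  also have "\<dots> = (\<integral>\<^sup>+x. ennreal (bump q l c x) \<partial>m)" by (simp only: layer)
  also have "\<dots> = ennreal (\<integral>x. bump q l c x \<partial>m)"
    using q l by (intro nn_integral_eq_integral integrable_bump) (auto simp: bump0)
  also have "(\<integral>\<^sup>+s. ennreal (V / l powr N) * (indicator I s * ennreal (s powr (N / q))) \<partial>lborel)
     = ennreal (V / l powr N) * (\<integral>\<^sup>+s. indicator I s * ennreal (s powr (N / q)) \<partial>lborel)"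
    by (rule nn_integral_cmult) (simp add: I_def)
  also have "(\<integral>\<^sup>+s. indicator I s * ennreal (s powr (N / q)) \<partial>lborel)
     = ennreal ((l powr q) powr (N / q + 1) / (N / q + 1))"
  proof -
    have "((\<lambda>s. s powr (N / q)) has_integral ((l powr q) powr (N / q + 1) / (N / q + 1))) I"
      unfolding I_def by (rule has_integral_powr_from_0) (use N q in \<open>auto intro: less_le_trans[of _ 0]\<close>)
    then have "(\<integral>\<^sup>+s. ennreal (indicator I s * s powr (N / q)) \<partial>lborel) = ennreal ((l powr q) powr (N / q + 1) / (N / q + 1))"
      by (rule nn_integral_has_integral_lebesgue[rotated]) auto
    then show ?thesis by (simp add: ennreal_mult ennreal_indicator)
  qed
  also have "ennreal (V / l powr N) * ennreal ((l powr q) powr (N / q + 1) / (N / q + 1))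
     = ennreal (V / l powr N * ((l powr q) powr (N / q + 1) / (N / q + 1)))"
    using N q by (intro ennreal_mult[symmetric]) (auto simp: V_def)
  also have "V / l powr N * ((l powr q) powr (N / q + 1) / (N / q + 1)) = V * l powr q * (q / (N + q))"
  proof -
    have "q * (N / q + 1) = N + q" using q by (simp add: field_simps)
    then have e1: "(l powr q) powr (N / q + 1) = l powr N * l powr q"
      unfolding powr_powr by (simp only: powr_add)
    have e2: "1 / (N / q + 1) = q / (N + q)" using q N by (simp add: field_simps)
    have "V / l powr N * (l powr N * l powr q / (N / q + 1)) = V * l powr q * (1 / (N / q + 1))"
      using l by simp
    then show ?thesis unfolding e1 e2 .
  qed
  finally have "ennreal (V * l powr q * (q / (N + q))) \<le> ennreal (\<integral>x. bump q l c x \<partial>m)" .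
  moreover have "0 \<le> (\<integral>x. bump q l c x \<partial>m)" by (rule integral_nonneg_AE) (simp add: bump0)
  ultimately show ?thesis by (simp only: ennreal_le_iff V_def)
qed

text \<open>The gradient term of the test function is controlled by I = l^q V - H, where H is its
  integral. Hence one lower bound for H estimates both sides of the Faber-Krahn inequality in terms
  of l and V alone.\<close>

lemma Faber_Krahn_volume_lower_bound:
  assumes CD: "CD 0 (real n) m" and n: "2 \<le> n" and p: "1 < p" "p < real n"
    and C: "0 < C"
    and FK: "\<And>u. u \<in> Lip0 \<Longrightarrow> Lq_norm m 1 u \<le> C * Lq_norm m p (local_slope u)
             * measure m (fun_support u) powr (1 - 1 / sobolev_exp p (real n))"
    and l: "0 < l"
  shows "(faber_krahn_const p (real n) / C) ^ n * (unit_ball_vol (real n) * l ^ n) \<le> measure m (ball c l)"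
proof -
  define q where "q = conj_exp p"
  define V where "V = measure m (ball c l)"
  define N where "N = real n"
  have N: "1 \<le> N" "0 < N" using n by (auto simp: N_def)
  \<comment> \<open>(q - 1) p = q turns the p-th power of the slope bound into a multiple of dist^q,
    and q / p = q - 1 later leaves a single factor l.\<close>
  have q: "1 < q" "(q - 1) * p = q" "q / p = q - 1" "1 / q = 1 - 1 / p"
    using p by (auto simp: q_def conj_exp_def field_simps)
  have V: "0 < V" unfolding V_def by (rule measure_ball_pos) fact
  have cb: "measure m (cball c l) = V"
    unfolding V_def using CD0_measure_cball_eq_ball[OF CD] N l by (simp add: N_def)
  define u where "u = bump q l c"
  define H where "H = (\<integral>x. u x \<partial>m)"
  define I where "I = (\<integral>x. indicator (cball c l) x * dist c x powr q \<partial>m)"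
  have H: "V * l powr q * (q / (N + q)) \<le> H"
    unfolding H_def u_def V_def N_def using CD0_integral_bump_ge[OF CD _ _ l] N q by (simp add: N_def)
  have Hpos: "0 < V * l powr q * (q / (N + q))" using V l q N by simp
  have int: "integrable m (\<lambda>x. indicator (cball c l) x * dist c x powr q)"
    by (rule integrable_bounded_support[of _ "l powr q" c l]) (use q l in \<open>auto simp: indicator_def powr_mono2\<close>)
  \<comment> \<open>The value of \<open>I\<close> for a Euclidean cone whose ball of radius l has
    volume V.\<close>
  define Y where "Y = l powr q * V * (N / (N + q))"
  have "I = (\<integral>x. l powr q * indicator (cball c l) x - u x \<partial>m)"
    unfolding I_def u_def by (intro Bochner_Integration.integral_cong) (auto simp: bump_eq indicator_def)
  also have "\<dots> = l powr q * V - H"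
    unfolding H_def u_def using q l emeasure_bounded_finite[of "cball c l"]
    by (subst Bochner_Integration.integral_diff) (auto simp: integrable_bump cb)
  finally have "I = l powr q * V - H" .
  then have "I \<le> l powr q * V - V * l powr q * (q / (N + q))" using H by simp
  also have "\<dots> = l powr q * V * (N / (N + q))" using N q by (simp add: field_simps)
  finally have I: "I \<le> Y" unfolding Y_def .
  have Y: "0 < Y" unfolding Y_def using V l q(1) N(2) by simp
  have "u \<in> Lip0"
    unfolding Lip0_def u_def
  proof (intro CollectI conjI exI)
    show "(q * l powr (q - 1))-lipschitz_on UNIV (bump q l c)" using q l by (intro lipschitz_bump) auto
    have "bounded (fun_support (bump q l c))" by (rule bounded_subset[OF bounded_cball fun_support_bump])
    then show "compact (fun_support (bump q l c))" using proper by (auto simp: proper_space_def fun_support_def)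
  qed
  from FK[OF this] have FKu: "Lq_norm m 1 u \<le> C * Lq_norm m p (local_slope u) * measure m (fun_support u) powr (1 - 1 / sobolev_exp p N)"
    by (simp add: N_def)
  \<comment> \<open>The exponent is positive, so the measure of the support may be enlarged to
    V.\<close>
  have se: "1 - 1 / sobolev_exp p N = 1 - 1 / p + 1 / N" "0 < 1 - 1 / p"
    using p N by (auto simp: sobolev_exp_def field_simps N_def)
  have u0: "0 \<le> u x" for x unfolding u_def bump_def using q l by (auto intro!: powr_mono2)
  have "Lq_norm m 1 u = H" unfolding Lq_norm_def H_def using u0 by (simp add: integral_nonneg_AE)
  note FKu[unfolded this]
  also have "C * Lq_norm m p (local_slope u) * measure m (fun_support u) powr (1 - 1 / sobolev_exp p N)
     \<le> C * (q * Y powr (1 / p)) * V powr (1 - 1 / p + 1 / N)"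
  proof (intro mult_mono)
    have "(\<integral>x. \<bar>local_slope u x\<bar> powr p \<partial>m) \<le> (\<integral>x. q powr p * (indicator (cball c l) x * dist c x powr q) \<partial>m)"
    proof (rule integral_mono')
      fix x
      have "\<bar>local_slope u x\<bar> powr p \<le> (indicator (cball c l) x * (q * dist c x powr (q - 1))) powr p"
        using local_slope_bump_le[OF q(1) less_imp_le[OF l], of c x] p local_slope_nonneg[of u x]
        by (intro powr_mono2) (auto simp: u_def)
      also have "\<dots> = q powr p * (indicator (cball c l) x * dist c x powr q)"
        using q by (auto simp: indicator_def powr_mult powr_powr)
      finally show "\<bar>local_slope u x\<bar> powr p \<le> q powr p * (indicator (cball c l) x * dist c x powr q)" .
    qed (use int in auto)
    also have "\<dots> = q powr p * I" by (simp add: I_def)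
    also have "\<dots> \<le> q powr p * Y" using I by (intro mult_left_mono) auto
    finally have "Lq_norm m p (local_slope u) \<le> (q powr p * Y) powr (1 / p)"
      unfolding Lq_norm_def using p by (intro powr_mono2) auto
    also have "\<dots> = q * Y powr (1 / p)"
      unfolding powr_mult using p q by (simp add: powr_powr)
    finally show "Lq_norm m p (local_slope u) \<le> q * Y powr (1 / p)" .
    have "measure m (fun_support u) \<le> measure m (cball c l)"
      unfolding u_def by (rule measure_mono_bounded[OF fun_support_bump]) (auto simp: fun_support_def)
    then show "measure m (fun_support u) powr (1 - 1 / sobolev_exp p N) \<le> V powr (1 - 1 / p + 1 / N)"
      unfolding se(1) cb using se(2) N by (intro powr_mono2) (auto intro: add_nonneg_nonneg less_imp_le)
  qed (use C q in \<open>auto simp: Lq_norm_def\<close>)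
  finally have "V * l powr q * (q / (N + q)) \<le> C * (q * Y powr (1 / p)) * V powr (1 - 1 / p + 1 / N)"
    using H by simp
  \<comment> \<open>Logarithms turn the product of powers into a linear inequality in ln l, ln V and
    the logarithms of the constants.\<close>
  then have "ln (V * l powr q * (q / (N + q))) \<le> ln (C * (q * Y powr (1 / p)) * V powr (1 - 1 / p + 1 / N))"
    using Hpos by (subst ln_le_cancel_iff) auto
  moreover have "ln (V * l powr q * (q / (N + q))) = ln V + q * ln l + (ln q - ln (N + q))"
    using V l q(1) N(2) by (simp add: ln_mult ln_div ln_powr)
  moreover have "ln (C * (q * Y powr (1 / p)) * V powr (1 - 1 / p + 1 / N))
      = ln C + (ln q + (1 / p) * ln Y) + (1 - 1 / p + 1 / N) * ln V"
    using V C q(1) Y by (simp add: ln_mult ln_powr)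
  moreover have "ln Y = q * ln l + ln V + (ln N - ln (N + q))"
    unfolding Y_def using V l q(1) N(2) by (simp add: ln_mult ln_div ln_powr)
  ultimately have "ln V + q * ln l - ln (N + q) \<le> ln C + (1 / p) * (q * ln l + ln V + (ln N - ln (N + q))) + (1 - 1 / p + 1 / N) * ln V"
    by simp
  moreover have "(1 / p) * (q * ln l) = q * ln l - ln l"
  proof -
    have "(1 / p) * (q * ln l) = (q / p) * ln l" by simp
    also have "\<dots> = q * ln l - ln l" unfolding q(3) by (simp add: algebra_simps)
    finally show ?thesis .
  qed
  moreover have "(1 / p) * (q * ln l + ln V + (ln N - ln (N + q)))
      = (1 / p) * (q * ln l) + ln V / p + (ln N / p - ln (N + q) / p)"
    by (simp add: add_divide_distrib diff_divide_distrib)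
  moreover have "(1 - 1 / p + 1 / N) * ln V = ln V - ln V / p + ln V / N"
    by (simp add: distrib_right left_diff_distrib)
  moreover have "(1 - 1 / p) * ln (N + q) = ln (N + q) - ln (N + q) / p"
    by (simp add: left_diff_distrib)
  \<comment> \<open>The logarithm of l N^(-1/p) (N + q)^(-1/q) \<le> C V^(1/N): the exponents of V
    differ by 1/N, those of l by 1.\<close>
  ultimately have main: "ln l - ln N / p - (1 - 1 / p) * ln (N + q) \<le> ln C + ln V / N"
    by linarith
  define \<omega> where "\<omega> = unit_ball_vol N"
  define F where "F = faber_krahn_const p N"
  have \<omega>: "0 < \<omega>" unfolding \<omega>_def using N by (intro unit_ball_vol_pos) auto
  have F_eq: "F = N powr (- 1 / p) * \<omega> powr (- 1 / N) * (N + q) powr (- 1 / q)"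
    by (simp add: F_def faber_krahn_const_def \<omega>_def q_def add.commute)
  have F: "0 < F" unfolding F_eq using N(2) \<omega> q(1) by simp
  have "ln F = (- 1 / p) * ln N + (- 1 / N) * ln \<omega> + (- 1 / q) * ln (N + q)"
    unfolding F_eq using N(2) \<omega> q(1) by (simp add: ln_mult ln_powr)
  moreover have "- 1 / q = - (1 - 1 / p)" using q(4) by simp
  ultimately have "ln F = - ln N / p - ln \<omega> / N - (1 - 1 / p) * ln (N + q)"
    by (simp only: mult_minus_left) simp
  \<comment> \<open>Adding ln \<omega> / N cancels the power of the unit ball volume contained in
    \<open>F\<close>.\<close>
  then have "ln l + (ln F + ln \<omega> / N) \<le> ln C + ln V / N" using main by simp
  then have "N * (ln l + (ln F + ln \<omega> / N)) \<le> N * (ln C + ln V / N)"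
    using N(2) by (intro mult_left_mono) auto
  then have "N * (ln F - ln C) + (ln \<omega> + N * ln l) \<le> ln V"
    using N(2) by (simp add: distrib_left right_diff_distrib)
  moreover have "ln ((F / C) ^ n * (\<omega> * l ^ n)) = N * (ln F - ln C) + (ln \<omega> + N * ln l)"
    using F C \<omega> l by (simp add: ln_mult ln_div ln_realpow N_def)
  ultimately have "ln ((F / C) ^ n * (\<omega> * l ^ n)) \<le> ln V" by simp
  then have "(F / C) ^ n * (\<omega> * l ^ n) \<le> V"
    using F C \<omega> l V by (subst (asm) ln_le_cancel_iff) auto
  then show ?thesis by (simp add: F_def \<omega>_def V_def N_def)
qed

end

section \<open>Vanishing of K and the volume bound\<close>

theorem theorem1p3:
  fixes m :: "'a::polish_space measure"
    and n :: nat and K p C :: real and x0 :: 'a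
  assumes "n \<ge> 2" and "K \<ge> 0"
    and "metric_measure_space m"
    and "proper_space TYPE('a)"
    and "CD K (real n) m"
    and "1 < p" and "p < real n"
    and "Liminf (at_right 0)
           (\<lambda>r. ereal (measure m (ball x0 r) / (unit_ball_vol (real n) * r ^ n))) = 1"
    and "C \<ge> faber_krahn_const p (real n)"
    and "\<forall>u\<in>Lip0. Lq_norm m 1 u \<le>
           C * Lq_norm m p (local_slope u)
             * measure m (fun_support u) powr (1 - 1 / sobolev_exp p (real n))"
  shows "K = 0 \<and>
         (\<forall>x. \<forall>r\<ge>0. measure m (ball x r) \<ge>
            (faber_krahn_const p (real n) / C) ^ n * (unit_ball_vol (real n) * r ^ n))"
proof -
  interpret proper_mms m using assms(3,4) by (rule proper_mms.intro)
  have "0 < conj_exp p" using assms(6) by (simp add: conj_exp_def)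
  moreover have "unit_ball_vol (real n) \<noteq> 0"
    using unit_ball_vol_pos[of "real n"] by (metis of_nat_0_le_iff less_irrefl)
  ultimately have "0 < faber_krahn_const p (real n)"
    using assms(1) unfolding faber_krahn_const_def
    by (intro mult_pos_pos powr_gt_zero[THEN iffD2]) simp_all
  \<comment> \<open>Positivity of \<open>C\<close> allows dividing by it and taking its
    logarithm.\<close>
  then have C: "0 < C" using assms(9) by simp
  have "K = 0"
  proof (rule ccontr)
    assume "K \<noteq> 0"
    then have bdd: "bounded (UNIV :: 'a set)"
      using CD_positive_bounded[OF assms(5)] assms(1,2) by simp
    \<comment> \<open>On a compact space the constant 1 is an admissible test function. Its slope is
      0, while its L^1 norm is the positive total measure.\<close>
    define u :: "'a \<Rightarrow> real" where "u = (\<lambda>_. 1)"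
    have "compact (UNIV :: 'a set)" using bdd proper by (auto simp: proper_space_def)
    then have "u \<in> Lip0"
      unfolding Lip0_def u_def fun_support_def by (auto intro!: exI[of _ 0] lipschitz_onI)
    then have "Lq_norm m 1 u \<le> C * Lq_norm m p (local_slope u)
             * measure m (fun_support u) powr (1 - 1 / sobolev_exp p (real n))"
      using assms(10) by blast
    moreover have "local_slope u x = 0" for x
    proof (rule antisym)
      show "local_slope u x \<le> 0" by (rule local_slope_le) (simp_all add: u_def)
    qed (rule local_slope_nonneg)
    then have "Lq_norm m p (local_slope u) = 0" by (simp add: Lq_norm_def)
    moreover have "Lq_norm m 1 u = measure m UNIV" by (simp add: Lq_norm_def u_def)
    moreover have "0 < measure m UNIV"
      using measure_ball_pos[of 1 x0] measure_mono_bounded[of "ball x0 1" UNIV] bdd by simp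
    ultimately show False by simp
  qed
  moreover have "(faber_krahn_const p (real n) / C) ^ n * (unit_ball_vol (real n) * r ^ n) \<le> measure m (ball x r)"
    if "0 \<le> r" for x r
  \<comment> \<open>At r = 0 both sides vanish: the ball is empty and 0^n = 0 as n > 0.\<close>
  proof (cases "r = 0")
    case False
    then show ?thesis
      using Faber_Krahn_volume_lower_bound[of n p C r x] assms C \<open>K = 0\<close> that by simp
  qed (use assms(1) in \<open>simp add: power_0_left\<close>)
  ultimately show ?thesis by blast
qed

end
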